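(* Let $a=(a_i)_{i\in\mathbb Z}$ be the special parameter sequence $a_i=i-\tfrac12$. For every Young diagram $\mu$, let $FS_\mu$ denote the unique element of $\Lambda$ such that for every Young diagram $\nu=(p_1,\dots,p_d\mid q_1,\dots,q_d)$ with $|\nu|=n\ge m=|\mu|$, $$\frac{\dim(\mu,\nu)}{\dim\nu}=\frac{FS_\mu(p_1+\tfrac12,\dots,p_d+\tfrac12;\,q_1+\tfrac12,\dots,q_d+\tfrac12)}{n(n-1)\cdots(n-m+1)}$$ (such an element exists, is unique, and has the form $s_\mu+{}$lower degree terms). Then $FS_\mu=s_{\mu;a}$ for every Young diagram $\mu$.
   Context: $\Lambda$ is the algebra of symmetric functions over $\mathbb C$, with complete homogeneous symmetric functions $h_k$, elementary symmetric functions $e_k$, power sums $\mathbf p_k$ and Schur functions $s_\mu$. For a sequence $a=(a_i)_{i\in\mathbb Z}$ of complex numbers define $h_{k;a}\in\Lambda$ for $k\ge1$ by $h_{k;a}=\sum_{i=1}^k(-1)^{k-i}e_{k-i}(a_1,\dots,a_{k-1})h_i$ (equivalently, $1+\sum_{k\ge1}\frac{h_{k;a}}{(u-a_1)\cdots(u-a_k)}=1+\sum_{k\ge1}h_ku^{-k}$ in $\Lambda[[u^{-1}]]$); set $h_{0;a}=1$ and $h_{k;a}=0$ for $k<0$. For $r\in\mathbb Z$ let $\tau^ra$ be the sequence $(\tau^ra)_i=a_{i+r}$. The multiparameter Schur function is $s_{\mu;a}=\det[h_{\mu_i-i+j;\,\tau^{1-j}a}]_{i,j=1}^N$ for any $N\ge\ell(\mu)$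 (the number of rows of $\mu$). Each $f\in\Lambda$ is identified with a function $f(x;y)$ of two vectors $x=(x_1,x_2,\dots)$, $y=(y_1,y_2,\dots)$ with finitely many nonzero coordinates, via the algebra homomorphism $\mathbf p_k\mapsto\sum_ix_i^k+(-1)^{k-1}\sum_jy_j^k$; for $x\in\mathbb C^m,y\in\mathbb C^n$, $f(x;y)$ means evaluation with all further coordinates set to $0$. Frobenius notation: a Young diagram $\nu$ with $d$ diagonal boxes is written $\nu=(p_1,\dots,p_d\mid q_1,\dots,q_d)$ with $p_i=\nu_i-i$, $q_i=\nu'_i-i$, where $\nu'$ is the transposed diagram; for $\nu=\varnothing$ the evaluation point is $(0;0)$. $\dim(\mu,\nu)$ is the number of standard tableaux of skew shape $\nu/\mu$ if $\mu\subseteq\nu$ and $0$ otherwise; $\dim\nu=\dim(\varnothing,\nu)$. *)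

theory Defs
  imports Complex_Main "HOL-Combinatorics.Permutations"
begin

text \<open>An element f of Lambda is identified with the function (x;y) |-> f(x;y), where
  x, y range over finite vectors of complex numbers (lists; further coordinates are 0).
  Lambda is the subalgebra of such functions generated by the power sums.\<close>

definition psum :: "nat \<Rightarrow> complex list \<Rightarrow> complex list \<Rightarrow> complex" where
  "psum k x y = (\<Sum>v\<leftarrow>x. v ^ k) + (-1) ^ (k - 1) * (\<Sum>v\<leftarrow>y. v ^ k)"

inductive_set Lambda :: "(complex list \<Rightarrow> complex list \<Rightarrow> complex) set" where
  const: "(\<lambda>x y. c) \<in> Lambda"
| power_sum: "k \<ge> 1 \<Longrightarrow> psum k \<in> Lambda"
| add: "f \<in> Lambda \<Longrightarrow> g \<in> Lambda \<Longrightarrow> (\<lambda>x y. f x y + g x y) \<in> Lambda"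
| mult: "f \<in> Lambda \<Longrightarrow> g \<in> Lambda \<Longrightarrow> (\<lambda>x y. f x y * g x y) \<in> Lambda"

fun hcomp :: "nat \<Rightarrow> complex list \<Rightarrow> complex" where
  "hcomp i [] = (if i = 0 then 1 else 0)"
| "hcomp i (a # x) = (\<Sum>t = 0..i. a ^ t * hcomp (i - t) x)"

fun esym :: "nat \<Rightarrow> complex list \<Rightarrow> complex" where
  "esym j [] = (if j = 0 then 1 else 0)"
| "esym j (a # x) = esym j x + (if j = 0 then 0 else a * esym (j - 1) x)"

text \<open>h_k(x;y): image of h_k under p_k |-> sum x_i^k + (-1)^(k-1) sum y_j^k,
  i.e. sum_k h_k(x;y) u^k = prod (1 + y_j u) / prod (1 - x_i u).\<close>
definition hsup :: "nat \<Rightarrow> complex list \<Rightarrow> complex list \<Rightarrow> complex" where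
  "hsup k x y = (\<Sum>i = 0..k. hcomp i x * esym (k - i) y)"

definition hpar :: "int \<Rightarrow> (int \<Rightarrow> complex) \<Rightarrow> complex list \<Rightarrow> complex list \<Rightarrow> complex" where
  "hpar k a x y =
     (if k < 0 then 0 else if k = 0 then 1 else
      (\<Sum>i = 1..nat k. (-1) ^ (nat k - i) * esym (nat k - i) (map a [1..k - 1]) * hsup i x y))"

definition shift :: "int \<Rightarrow> (int \<Rightarrow> complex) \<Rightarrow> (int \<Rightarrow> complex)" where
  "shift r a = (\<lambda>i. a (i + r))"

definition detN :: "nat \<Rightarrow> (nat \<Rightarrow> nat \<Rightarrow> complex) \<Rightarrow> complex" where
  "detN N M = (\<Sum>p | p permutes {1..N}. of_int (sign p) * (\<Prod>i = 1..N. M i (p i)))"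

definition young :: "nat list \<Rightarrow> bool" where
  "young \<mu> \<longleftrightarrow> sorted_wrt (\<ge>) \<mu> \<and> 0 \<notin> set \<mu>"

definition row :: "nat list \<Rightarrow> nat \<Rightarrow> nat" where
  "row \<mu> i = (if 1 \<le> i \<and> i \<le> length \<mu> then \<mu> ! (i - 1) else 0)"

definition col :: "nat list \<Rightarrow> nat \<Rightarrow> nat" where
  "col \<mu> j = card {i. 1 \<le> i \<and> i \<le> length \<mu> \<and> j \<le> row \<mu> i}"

definition cells :: "nat list \<Rightarrow> (nat \<times> nat) set" where
  "cells \<mu> = {(i, j). 1 \<le> i \<and> i \<le> length \<mu> \<and> 1 \<le> j \<and> j \<le> row \<mu> i}"

definition schur_par :: "(int \<Rightarrow> complex) \<Rightarrow> nat list \<Rightarrow> complex list \<Rightarrow> complex list \<Rightarrow> complex" where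
  "schur_par a \<mu> x y =
     detN (length \<mu>) (\<lambda>i j. hpar (int (row \<mu> i) - int i + int j) (shift (1 - int j) a) x y)"

definition diag :: "nat list \<Rightarrow> nat" where
  "diag \<nu> = card {i. 1 \<le> i \<and> i \<le> length \<nu> \<and> i \<le> row \<nu> i}"

definition frob_x :: "nat list \<Rightarrow> complex list" where
  "frob_x \<nu> = map (\<lambda>i. of_int (int (row \<nu> i) - int i) + 1/2) [1..<diag \<nu> + 1]"

definition frob_y :: "nat list \<Rightarrow> complex list" where
  "frob_y \<nu> = map (\<lambda>i. of_int (int (col \<nu> i) - int i) + 1/2) [1..<diag \<nu> + 1]"

definition std_tableaux :: "nat list \<Rightarrow> nat list \<Rightarrow> ((nat \<times> nat) \<Rightarrow> nat) set" where
  "std_tableaux \<mu> \<nu> =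
     (let S = cells \<nu> - cells \<mu> in
      {T. bij_betw T S {1..card S} \<and> (\<forall>c. c \<notin> S \<longrightarrow> T c = 0)
        \<and> (\<forall>i j j'. (i, j) \<in> S \<and> (i, j') \<in> S \<and> j < j' \<longrightarrow> T (i, j) < T (i, j'))
        \<and> (\<forall>i i' j. (i, j) \<in> S \<and> (i', j) \<in> S \<and> i < i' \<longrightarrow> T (i, j) < T (i', j))})"

definition dimsk :: "nat list \<Rightarrow> nat list \<Rightarrow> nat" where
  "dimsk \<mu> \<nu> = (if cells \<mu> \<subseteq> cells \<nu> then card (std_tableaux \<mu> \<nu>) else 0)"

definition dimd :: "nat list \<Rightarrow> nat" where
  "dimd \<nu> = dimsk [] \<nu>"

definition FS_property :: "nat list \<Rightarrow> (complex list \<Rightarrow> complex list \<Rightarrow> complex) \<Rightarrow> bool" where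
  "FS_property \<mu> f \<longleftrightarrow>
     (\<forall>\<nu>. young \<nu> \<and> sum_list \<nu> \<ge> sum_list \<mu> \<longrightarrow>
        of_nat (dimsk \<mu> \<nu>) / of_nat (dimd \<nu>) =
        f (frob_x \<nu>) (frob_y \<nu>) /
          (\<Prod>t < sum_list \<mu>. of_nat (sum_list \<nu> - t)))"

definition FS :: "nat list \<Rightarrow> (complex list \<Rightarrow> complex list \<Rightarrow> complex)" where
  "FS \<mu> = (THE f. f \<in> Lambda \<and> FS_property \<mu> f)"

definition a_half :: "int \<Rightarrow> complex" where
  "a_half i = of_int i - 1/2"

end

theory Submission
  imports Defs "HOL-Library.FuncSet" "HOL-Computational_Algebra.Formal_Power_Series"
    "HOL-Computational_Algebra.Polynomial"
begin

text \<open>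
  By telescoping over contents, the power sums at the modified Frobenius coordinates of \<open>\<nu>\<close> equal
  those at \<open>(\<nu>\<^sub>i - i + 1/2; i - 1/2)\<close>, \<open>1 \<le> i \<le> N\<close>.  At such a point \<open>h\<^sub>k\<close> is a divided difference with
  nodes \<open>\<nu>\<^sub>i - i + 1/2\<close>, so the Jacobi-Trudi matrix of the multiparameter Schur function factors as
  a matrix of falling factorials \<open>(\<nu>\<^sub>i + N - i)\<down>(\<mu>\<^sub>j + N - j)\<close> times a matrix that does not depend on \<open>\<mu>\<close>.
  The determinant of the first factor vanishes unless \<open>\<mu> \<subseteq> \<nu>\<close> and satisfies the Pieri rule
  \<open>(|\<nu>| - |\<mu>|) A(\<mu>) = \<Sum> A(\<mu>\<^sup>+)\<close>, the sum being over all ways to add a box to \<open>\<mu>\<close>.  Hence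
  \<open>A(\<mu>) (|\<nu>| - |\<mu>|)! = dim(\<mu>,\<nu>) A(\<nu>)\<close>, and the empty diagram fixes the normalisation.
  Uniqueness holds because a polynomial in the power sums that vanishes at all large diagrams
  vanishes identically, as one sees by freeing one coordinate after another.
\<close>

section \<open>Determinants\<close>

lemma detN_cong:
  assumes "\<And>i j. i \<in> {1..N} \<Longrightarrow> j \<in> {1..N} \<Longrightarrow> M i j = M' i j"
  shows "detN N M = detN N M'"
  unfolding detN_def
proof (intro sum.cong refl arg_cong2[where f = "(*)"] prod.cong)
  fix p i assume "p \<in> {p. p permutes {1..N}}" "i \<in> {1..N}"
  then show "M i (p i) = M' i (p i)" using assms permutes_in_image[of p "{1..N}" i] by auto
qed

lemma detN_permute_rows:
  assumes q: "q permutes {1..N}"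
  shows "detN N (\<lambda>i. M (q i)) = of_int (sign q) * detN N M"
proof -
  have fin: "finite {1..N}" by simp
  have "detN N (\<lambda>i. M (q i)) =
      (\<Sum>p | p permutes {1..N}. of_int (sign (p \<circ> q)) * (\<Prod>i=1..N. M (q i) ((p \<circ> q) i)))"
    unfolding detN_def
    by (rule sum_permutations_compose_right[OF q])
  also have "\<dots> = (\<Sum>p | p permutes {1..N}. of_int (sign q) * (of_int (sign p) * (\<Prod>i=1..N. M i (p i))))"
  proof (intro sum.cong refl)
    fix p assume "p \<in> {p. p permutes {1..N}}"
    then have p: "p permutes {1..N}" by simp
    have "(\<Prod>i=1..N. M (q i) ((p \<circ> q) i)) = (\<Prod>i=1..N. M i (p i))"
      using prod.permute[OF q, of "\<lambda>i. M i (p i)"] by (simp add: o_def)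
    moreover have "sign (p \<circ> q) = sign p * sign q"
      using p q fin by (intro sign_compose) (auto intro: permutes_imp_permutation)
    ultimately show "of_int (sign (p \<circ> q)) * (\<Prod>i=1..N. M (q i) ((p \<circ> q) i))
        = of_int (sign q) * (of_int (sign p) * (\<Prod>i=1..N. M i (p i)))" by simp
  qed
  also have "\<dots> = of_int (sign q) * detN N M" by (simp add: detN_def sum_distrib_left)
  finally show ?thesis .
qed

text \<open>Swapping the two rows changes the sign and leaves the matrix as it is, so the value
  equals its own negative.\<close>

lemma detN_equal_rows:
  assumes "i \<in> {1..N}" "j \<in> {1..N}" "i \<noteq> j" "M i = M j"
  shows "detN N M = 0"
proof -
  have q: "transpose i j permutes {1..N}" using assms by (intro permutes_swap_id)
  have "M (transpose i j k) = M k" for k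
    using assms by (auto simp: transpose_def)
  then have "detN N M = of_int (sign (transpose i j)) * detN N M"
    using detN_permute_rows[OF q, of M] by simp
  then show ?thesis using assms by (simp add: sign_swap_id)
qed

text \<open>Translates between the choice functions of \<open>prod_sum_PiE\<close>, which are
  \<open>undefined\<close> off \<open>A\<close>, and permutations, which are the identity there. An
  injective self-map of a finite set is onto.\<close>

lemma bij_betw_restrict_permutes:
  assumes "finite A"
  shows "bij_betw (\<lambda>p. restrict p A) {p. p permutes A} {f \<in> A \<rightarrow>\<^sub>E A. inj_on f A}"
proof (rule bij_betw_byWitness[where f' = "\<lambda>f x. if x \<in> A then f x else x"])
  show "\<forall>p\<in>{p. p permutes A}. (\<lambda>x. if x \<in> A then restrict p A x else x) = p"
    by (auto simp: fun_eq_iff permutes_def)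
  show "\<forall>f\<in>{f \<in> A \<rightarrow>\<^sub>E A. inj_on f A}. restrict (\<lambda>x. if x \<in> A then f x else x) A = f"
    by (auto simp: fun_eq_iff restrict_def PiE_def extensional_def)
  show "(\<lambda>p. restrict p A) ` {p. p permutes A} \<subseteq> {f \<in> A \<rightarrow>\<^sub>E A. inj_on f A}"
    by (auto simp: permutes_in_image inj_on_restrict_eq permutes_inj_on)
  show "(\<lambda>f x. if x \<in> A then f x else x) ` {f \<in> A \<rightarrow>\<^sub>E A. inj_on f A} \<subseteq> {p. p permutes A}"
  proof safe
    fix f assume f: "f \<in> A \<rightarrow>\<^sub>E A" "inj_on f A"
    then have "f ` A = A" using assms by (intro endo_inj_surj) auto
    then have "bij_betw f A A" using f by (simp add: bij_betw_def)
    then have "bij_betw (\<lambda>x. if x \<in> A then f x else x) A A" by (rule bij_betw_cong[THEN iffD1, rotated]) auto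
    then show "(\<lambda>x. if x \<in> A then f x else x) permutes A" by (rule bij_imp_permutes) auto
  qed
qed

text \<open>Multiply out the row sums: each term picks a function \<open>f\<close> of row indices. A
  repeated value of \<open>f\<close> gives two equal rows of \<open>B\<close>; an injective
  \<open>f\<close> is a permutation and contributes its sign.\<close>

lemma detN_mult:
  "detN N (\<lambda>i k. \<Sum>l=1..N. A i l * B l k) = detN N A * detN N B"
proof -
  let ?I = "{1..N}"
  have "detN N (\<lambda>i k. \<Sum>l=1..N. A i l * B l k) =
      (\<Sum>p | p permutes ?I. of_int (sign p) * (\<Sum>f\<in>?I \<rightarrow>\<^sub>E ?I. \<Prod>i\<in>?I. A i (f i) * B (f i) (p i)))"
    unfolding detN_def by (subst prod_sum_PiE) auto
  also have "\<dots> = (\<Sum>p | p permutes ?I. \<Sum>f\<in>?I \<rightarrow>\<^sub>E ?I.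
      (\<Prod>i\<in>?I. A i (f i)) * (of_int (sign p) * (\<Prod>i\<in>?I. B (f i) (p i))))"
    by (simp add: sum_distrib_left prod.distrib mult_ac)
  also have "\<dots> = (\<Sum>f\<in>?I \<rightarrow>\<^sub>E ?I. (\<Prod>i\<in>?I. A i (f i)) * detN N (\<lambda>i. B (f i)))"
    by (subst sum.swap) (simp add: detN_def sum_distrib_left)
  also have "\<dots> = (\<Sum>f\<in>{f \<in> ?I \<rightarrow>\<^sub>E ?I. inj_on f ?I}. (\<Prod>i\<in>?I. A i (f i)) * detN N (\<lambda>i. B (f i)))"
  proof (rule sum.mono_neutral_right)
    show "\<forall>f\<in>(?I \<rightarrow>\<^sub>E ?I) - {f \<in> ?I \<rightarrow>\<^sub>E ?I. inj_on f ?I}. (\<Prod>i\<in>?I. A i (f i)) * detN N (\<lambda>i. B (f i)) = 0"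
    proof
      fix f assume "f \<in> (?I \<rightarrow>\<^sub>E ?I) - {f \<in> ?I \<rightarrow>\<^sub>E ?I. inj_on f ?I}"
      then obtain i j where "i \<in> ?I" "j \<in> ?I" "i \<noteq> j" "f i = f j" by (auto simp: inj_on_def)
      then have "detN N (\<lambda>i. B (f i)) = 0" by (intro detN_equal_rows[of i N j]) auto
      then show "(\<Prod>i\<in>?I. A i (f i)) * detN N (\<lambda>i. B (f i)) = 0" by simp
    qed
  qed (auto intro: finite_PiE)
  also have "\<dots> = (\<Sum>q | q permutes ?I. (\<Prod>i\<in>?I. A i (restrict q ?I i)) * detN N (\<lambda>i. B (restrict q ?I i)))"
    by (rule sum.reindex_bij_betw[OF bij_betw_restrict_permutes, symmetric]) simp
  also have "\<dots> = (\<Sum>q | q permutes ?I. of_int (sign q) * (\<Prod>i\<in>?I. A i (q i)) * detN N B)"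
  proof (intro sum.cong refl)
    fix q assume "q \<in> {q. q permutes ?I}"
    then have "detN N (\<lambda>i. B (q i)) = of_int (sign q) * detN N B" by (intro detN_permute_rows) simp
    moreover have "detN N (\<lambda>i. B (restrict q ?I i)) = detN N (\<lambda>i. B (q i))"
      by (rule detN_cong) simp
    moreover have "(\<Prod>i\<in>?I. A i (restrict q ?I i)) = (\<Prod>i\<in>?I. A i (q i))" by (rule prod.cong) auto
    ultimately show "(\<Prod>i\<in>?I. A i (restrict q ?I i)) * detN N (\<lambda>i. B (restrict q ?I i)) =
       of_int (sign q) * (\<Prod>i\<in>?I. A i (q i)) * detN N B" by simp
  qed
  also have "\<dots> = detN N A * detN N B" by (simp add: detN_def sum_distrib_right)
  finally show ?thesis .
qed

text \<open>Pigeonhole: a permutation cannot send the first \<open>r\<close> rows into only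
  \<open>r - 1\<close> columns, so every product meets the zero block.\<close>

lemma detN_zero_block:
  assumes r: "r \<in> {1..N}" and z: "\<And>i j. 1 \<le> i \<Longrightarrow> i \<le> r \<Longrightarrow> r \<le> j \<Longrightarrow> j \<le> N \<Longrightarrow> M i j = 0"
  shows "detN N M = 0"
  unfolding detN_def
proof (rule sum.neutral, rule ballI)
  fix p assume "p \<in> {p. p permutes {1..N}}"
  then have p: "p permutes {1..N}" by simp
  have "\<not> p ` {1..r} \<subseteq> {1..<r}"
  proof
    assume "p ` {1..r} \<subseteq> {1..<r}"
    then have "card (p ` {1..r}) \<le> card {1..<r}" by (intro card_mono) auto
    moreover have "card (p ` {1..r}) = r" using permutes_inj_on[OF p] by (simp add: card_image)
    ultimately show False using r by auto
  qed
  then obtain i where i: "1 \<le> i" "i \<le> r" "p i \<notin> {1..<r}"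
    by (meson atLeastAtMost_iff image_subsetI)
  then have "p i \<in> {1..N}" using permutes_in_image[OF p, of i] r by auto
  then have "M i (p i) = 0" using i by (intro z) auto
  then have "(\<Prod>i=1..N. M i (p i)) = 0" using i r by (intro prod_zero) auto
  then show "of_int (sign p) * (\<Prod>i=1..N. M i (p i)) = 0" by simp
qed

lemma detN_Suc_unit_row:
  assumes "\<And>j. 1 \<le> j \<Longrightarrow> j \<le> N \<Longrightarrow> M (Suc N) j = 0" "M (Suc N) (Suc N) = 1"
  shows "detN (Suc N) M = detN N M"
proof -
  have "detN N M = (\<Sum>p | p permutes {1..N}. of_int (sign p) * (\<Prod>i=1..Suc N. M i (p i)))"
    unfolding detN_def
    by (intro sum.cong refl) (auto simp: permutes_def assms)
  also have "\<dots> = detN (Suc N) M" unfolding detN_def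
  proof (rule sum.mono_neutral_left)
    show "{p. p permutes {1..N}} \<subseteq> {p. p permutes {1..Suc N}}"
      by (auto elim: permutes_subset)
    show "\<forall>p\<in>{p. p permutes {1..Suc N}} - {p. p permutes {1..N}}.
       of_int (sign p) * (\<Prod>i=1..Suc N. M i (p i)) = 0"
    proof
      fix p assume "p \<in> {p. p permutes {1..Suc N}} - {p. p permutes {1..N}}"
      then have p: "p permutes {1..Suc N}" "\<not> p permutes {1..N}" by auto
      have "p (Suc N) \<noteq> Suc N"
      proof
        assume "p (Suc N) = Suc N"
        then have "p permutes {1..N}" using p(1)
          by (intro permutes_superset[OF p(1)]) (auto simp: le_Suc_eq)
        then show False using p(2) by simp
      qed
      moreover have "p (Suc N) \<in> {1..Suc N}" using permutes_in_image[OF p(1), of "Suc N"] by auto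
      ultimately have "M (Suc N) (p (Suc N)) = 0" by (intro assms) auto
      then show "of_int (sign p) * (\<Prod>i=1..Suc N. M i (p i)) = 0" by simp
    qed
  qed (simp add: finite_permutations)
  finally show ?thesis by simp
qed

text \<open>This is why the size of the Jacobi-Trudi determinant may be any number above the number
  of rows of the diagram: extra empty rows only add a unitriangular corner.\<close>

lemma detN_unitriangular_padding:
  assumes "n \<le> N" "\<And>i j. n < i \<Longrightarrow> i \<le> N \<Longrightarrow> 1 \<le> j \<Longrightarrow> j < i \<Longrightarrow> M i j = 0"
    "\<And>i. n < i \<Longrightarrow> i \<le> N \<Longrightarrow> M i i = 1"
  shows "detN N M = detN n M"
  using assms
proof (induction N rule: dec_induct)
  case (step N)
  have "detN (Suc N) M = detN N M" using step by (intro detN_Suc_unit_row) auto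
  then show ?case using step by simp
qed simp

section \<open>Standard fillings of finite sets of boxes\<close>

text \<open>The encoding of \<open>std_tableaux\<close> for an arbitrary set of boxes, so that boxes
  can be removed one by one without naming a new inner diagram.\<close>

definition syt :: "(nat \<times> nat) set \<Rightarrow> (nat \<times> nat \<Rightarrow> nat) set" where
  "syt S = {T. bij_betw T S {1..card S} \<and> (\<forall>c. c \<notin> S \<longrightarrow> T c = 0)
     \<and> (\<forall>i j j'. (i, j) \<in> S \<and> (i, j') \<in> S \<and> j < j' \<longrightarrow> T (i, j) < T (i, j'))
     \<and> (\<forall>i i' j. (i, j) \<in> S \<and> (i', j) \<in> S \<and> i < i' \<longrightarrow> T (i, j) < T (i', j))}"

lemma std_tableaux_eq_syt: "std_tableaux \<mu> \<nu> = syt (cells \<nu> - cells \<mu>)"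
  by (simp add: std_tableaux_def syt_def Let_def)

lemma sytI:
  assumes "bij_betw T S {1..card S}" "\<And>c. c \<notin> S \<Longrightarrow> T c = 0"
    "\<And>i j j'. (i, j) \<in> S \<Longrightarrow> (i, j') \<in> S \<Longrightarrow> j < j' \<Longrightarrow> T (i, j) < T (i, j')"
    "\<And>i i' j. (i, j) \<in> S \<Longrightarrow> (i', j) \<in> S \<Longrightarrow> i < i' \<Longrightarrow> T (i, j) < T (i', j)"
  shows "T \<in> syt S"
  using assms unfolding syt_def by blast

lemma sytD:
  assumes "T \<in> syt S"
  shows syt_bij: "bij_betw T S {1..card S}"
    and syt_out: "\<And>c. c \<notin> S \<Longrightarrow> T c = 0"
    and syt_row: "\<And>i j j'. (i, j) \<in> S \<Longrightarrow> (i, j') \<in> S \<Longrightarrow> j < j' \<Longrightarrow> T (i, j) < T (i, j')"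
    and syt_col: "\<And>i i' j. (i, j) \<in> S \<Longrightarrow> (i', j) \<in> S \<Longrightarrow> i < i' \<Longrightarrow> T (i, j) < T (i', j)"
  using assms unfolding syt_def by blast+

lemma syt_range: "T \<in> syt S \<Longrightarrow> c \<in> S \<Longrightarrow> T c \<in> {1..card S}"
  using syt_bij bij_betwE by blast

lemma syt_empty: "syt {} = {\<lambda>_. 0}"
  by (auto simp: syt_def bij_betw_def)

text \<open>Among the boxes of \<open>S\<close>, these are the ones that can carry the entry
  1.\<close>

definition min_cell :: "(nat \<times> nat) set \<Rightarrow> nat \<times> nat \<Rightarrow> bool" where
  "min_cell S c \<longleftrightarrow> (\<forall>j. (fst c, j) \<in> S \<longrightarrow> snd c \<le> j) \<and> (\<forall>i. (i, snd c) \<in> S \<longrightarrow> fst c \<le> i)"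

lemma finite_syt:
  assumes "finite S" shows "finite (syt S)"
proof (rule finite_subset)
  show "syt S \<subseteq> {T. \<forall>c. (c \<in> S \<longrightarrow> T c \<in> {1..card S}) \<and> (c \<notin> S \<longrightarrow> T c = 0)}"
    using syt_range syt_out by auto
  show "finite {T. \<forall>c. (c \<in> S \<longrightarrow> T c \<in> {1..card S}) \<and> (c \<notin> S \<longrightarrow> T c = 0)}"
    using assms by (intro finite_set_of_finite_funs) auto
qed

text \<open>Truncated subtraction serves both purposes: it lowers the entries on
  \<open>S - {c}\<close> and yields 0 at \<open>c\<close> and outside \<open>S\<close>.\<close>

lemma syt_remove_one:
  assumes S: "finite S" and c: "c \<in> S" and T: "T \<in> syt S" "T c = 1"
  shows "(\<lambda>s. T s - 1) \<in> syt (S - {c})"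
proof -
  obtain n where n: "card S = Suc n" using S c by (cases "card S") auto
  have bij: "bij_betw T S {1..Suc n}" using syt_bij T n by metis
  have "bij_betw T (S - {c}) ({1..Suc n} - {1})"
    using bij_betw_DiffI[OF bij, of "{c}" "{1}"] c T(2) by (simp add: bij_betw_def)
  moreover have "bij_betw (\<lambda>k. k - 1) ({1..Suc n} - {1}) {1..n}"
    by (rule bij_betw_byWitness[where f' = Suc]) auto
  ultimately have "bij_betw ((\<lambda>k. k - 1) \<circ> T) (S - {c}) {1..n}" by (rule bij_betw_trans)
  then have bij': "bij_betw (\<lambda>s. T s - 1) (S - {c}) {1..card (S - {c})}"
    using S c n by (simp add: o_def)
  have less: "T s - 1 < T s' - 1" if "s \<in> S - {c}" "T s < T s'" for s s'
    using syt_range[OF T(1), of s] that by auto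
  have out: "T s - 1 = 0" if "s \<notin> S - {c}" for s
    using that syt_out[OF T(1), of s] T(2) by (cases "s = c") auto
  show ?thesis
    by (rule sytI[OF bij' out]) (use less syt_row[OF T(1)] syt_col[OF T(1)] in auto)
qed

text \<open>A filling of \<open>S - {c}\<close> is 0 at \<open>c\<close>, so raising all values on
  \<open>S\<close> by one puts the entry 1 there. Minimality of \<open>c\<close> ensures that no box
  has to carry a smaller entry than \<open>c\<close>.\<close>

lemma syt_insert_one:
  assumes S: "finite S" and c: "c \<in> S" "min_cell S c" and T: "T \<in> syt (S - {c})"
  shows "(\<lambda>s. if s \<in> S then Suc (T s) else 0) \<in> syt S" (is "?U \<in> _")
proof -
  obtain n where n: "card S = Suc n" "card (S - {c}) = n" using S c by (cases "card S") auto
  have bij: "bij_betw T (S - {c}) {1..n}" using syt_bij T n by metis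
  have T0: "T c = 0" using syt_out[OF T] by simp
  have "bij_betw (Suc \<circ> T) (S - {c}) {Suc 1..Suc n}"
    using bij by (rule bij_betw_trans) (simp add: bij_betw_def image_Suc_atLeastAtMost)
  then have "bij_betw ?U (S - {c}) {Suc 1..Suc n}"
    by (rule bij_betw_cong[THEN iffD1, rotated]) auto
  moreover have "bij_betw ?U {c} {1}" using c T0 by (simp add: bij_betw_def)
  ultimately have "bij_betw ?U ((S - {c}) \<union> {c}) ({Suc 1..Suc n} \<union> {1})"
    by (rule bij_betw_combine) auto
  moreover have "(S - {c}) \<union> {c} = S" "{Suc 1..Suc n} \<union> {1} = {1..Suc n}" using c by auto
  ultimately have bijU: "bij_betw ?U S {1..card S}" using n by simp
  have pos: "T s > 0" if "s \<in> S - {c}" for s using syt_range[OF T that] by simp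
  have less: "T (i, j) < T (i, j')" if "(i, j) \<in> S" "(i, j') \<in> S" "j < j'" for i j j'
  proof -
    have "(i, j') \<noteq> c" using that c(2) by (auto simp: min_cell_def)
    then show ?thesis using that syt_row[OF T] T0 pos[of "(i, j')"] by (cases "(i, j) = c") auto
  qed
  have less': "T (i, j) < T (i', j)" if "(i, j) \<in> S" "(i', j) \<in> S" "i < i'" for i i' j
  proof -
    have "(i', j) \<noteq> c" using that c(2) by (auto simp: min_cell_def)
    then show ?thesis using that syt_col[OF T] T0 pos[of "(i', j)"] by (cases "(i, j) = c") auto
  qed
  show ?thesis by (rule sytI[OF bijU]) (use less less' in auto)
qed

lemma card_syt_one_at:
  assumes S: "finite S" and c: "c \<in> S"
  shows "card {T \<in> syt S. T c = 1} = (if min_cell S c then card (syt (S - {c})) else 0)"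
proof (cases "min_cell S c")
  case True
  have "bij_betw (\<lambda>T s. T s - 1) {T \<in> syt S. T c = 1} (syt (S - {c}))"
  proof (rule bij_betw_byWitness[where f' = "\<lambda>T s. if s \<in> S then Suc (T s) else 0"])
    show "\<forall>T\<in>{T \<in> syt S. T c = 1}. (\<lambda>s. if s \<in> S then Suc (T s - 1) else 0) = T"
    proof
      fix T assume T: "T \<in> {T \<in> syt S. T c = 1}"
      have "T s \<ge> 1" if "s \<in> S" for s using T that syt_range by fastforce
      moreover have "T s = 0" if "s \<notin> S" for s using T that syt_out by blast
      ultimately show "(\<lambda>s. if s \<in> S then Suc (T s - 1) else 0) = T" by (fastforce simp: fun_eq_iff)
    qed
    show "\<forall>T\<in>syt (S - {c}). (\<lambda>s. (if s \<in> S then Suc (T s) else 0) - 1) = T"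
    proof
      fix T assume T: "T \<in> syt (S - {c})"
      have "T s = 0" if "s \<notin> S" for s using T that syt_out by blast
      then show "(\<lambda>s. (if s \<in> S then Suc (T s) else 0) - 1) = T" by (simp add: fun_eq_iff)
    qed
    show "(\<lambda>T s. T s - 1) ` {T \<in> syt S. T c = 1} \<subseteq> syt (S - {c})"
      using syt_remove_one[OF S c] by auto
    show "(\<lambda>T s. if s \<in> S then Suc (T s) else 0) ` syt (S - {c}) \<subseteq> {T \<in> syt S. T c = 1}"
      using syt_insert_one[OF S c True] c syt_out[of _ "S - {c}" c] by auto
  qed
  then show ?thesis using True by (simp add: bij_betw_same_card)
next
  case False
  \<comment> \<open>A box to the left of \<open>c\<close> or above it would need an entry below
    1.\<close>
  have False if T: "T \<in> syt S" "T c = 1" for T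
  proof -
    obtain i j where ij: "c = (i, j)" by (cases c)
    consider j' where "(i, j') \<in> S" "j' < j" | i' where "(i', j) \<in> S" "i' < i"
      using False unfolding ij min_cell_def by (auto simp: not_le)
    then obtain s where "s \<in> S" "T s < T c"
      using syt_row[OF T(1)] syt_col[OF T(1)] c unfolding ij by cases blast+
    moreover have "T s \<ge> 1" using syt_range[OF T(1) \<open>s \<in> S\<close>] by simp
    ultimately show False using T(2) by simp
  qed
  then have none: "{T \<in> syt S. T c = 1} = {}" by blast
  show ?thesis unfolding none using False by simp
qed

text \<open>Fillings are sorted by the box of the entry 1. Removing the smallest entry, not the
  largest, enlarges the inner diagram and keeps the outer one fixed, as in the Pieri rule
  below.\<close>

lemma card_syt_rec:
  assumes S: "finite S" "S \<noteq> {}"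
  shows "card (syt S) = (\<Sum>c | c \<in> S \<and> min_cell S c. card (syt (S - {c})))"
proof -
  have "syt S = (\<Union>c\<in>S. {T \<in> syt S. T c = 1})"
  proof -
    have "\<exists>c\<in>S. T c = 1" if "T \<in> syt S" for T
    proof -
      have "1 \<in> {1..card S}" using S by (simp add: Suc_le_eq card_gt_0_iff)
      then have "1 \<in> T ` S" using syt_bij[OF that] by (simp add: bij_betw_def)
      then show ?thesis by auto
    qed
    then show ?thesis by auto
  qed
  moreover have "{T \<in> syt S. T c = 1} \<inter> {T \<in> syt S. T c' = 1} = {}"
    if "c \<in> S" "c' \<in> S" "c \<noteq> c'" for c c'
  proof -
    have False if "T \<in> syt S" "T c = 1" "T c' = 1" for T
    proof -
      have "inj_on T S" using syt_bij that bij_betw_def by blast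
      then show False using that \<open>c \<in> S\<close> \<open>c' \<in> S\<close> \<open>c \<noteq> c'\<close> by (metis inj_onD)
    qed
    then show ?thesis by blast
  qed
  ultimately have "card (syt S) = (\<Sum>c\<in>S. card {T \<in> syt S. T c = 1})"
    using S finite_syt[OF S(1)] card_UN_disjoint[of S "\<lambda>c. {T \<in> syt S. T c = 1}"] by auto
  also have "\<dots> = (\<Sum>c\<in>S. if min_cell S c then card (syt (S - {c})) else 0)"
    using S by (intro sum.cong refl card_syt_one_at)
  also have "\<dots> = (\<Sum>c | c \<in> S \<and> min_cell S c. card (syt (S - {c})))"
    using S by (simp add: sum.If_cases Collect_conj_eq)
  finally show ?thesis .
qed

section \<open>Newton's identity and membership in Lambda\<close>

lemma hcomp_Suc_Cons: "hcomp (Suc m) (a # x) = hcomp (Suc m) x + a * hcomp m (a # x)"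
  unfolding hcomp.simps sum.atLeast0_atMost_Suc_shift by (simp add: sum_distrib_left mult_ac)

lemma hcomp_0 [simp]: "hcomp 0 x = 1" by (induction x) auto

lemma esym_0 [simp]: "esym 0 x = 1" by (induction x) auto

text \<open>The factor 1/(1 - a X) of the generating function, multiplied out so that no inverse
  series occurs.\<close>

lemma fps_hcomp_Cons:
  "Abs_fps (\<lambda>k. hcomp k x) = (1 - fps_const a * fps_X) * Abs_fps (\<lambda>k. hcomp k (a # x))"
proof (rule fps_ext)
  fix n
  show "fps_nth (Abs_fps (\<lambda>k. hcomp k x)) n =
      fps_nth ((1 - fps_const a * fps_X) * Abs_fps (\<lambda>k. hcomp k (a # x))) n"
    using hcomp_Suc_Cons[of "n - 1" a x] by (cases n) (simp_all add: left_diff_distrib mult.assoc)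
qed

lemma fps_esym_Cons:
  "Abs_fps (\<lambda>k. esym k (a # y)) = (1 + fps_const a * fps_X) * Abs_fps (\<lambda>k. esym k y)"
proof (rule fps_ext)
  fix n
  show "fps_nth (Abs_fps (\<lambda>k. esym k (a # y))) n =
      fps_nth ((1 + fps_const a * fps_X) * Abs_fps (\<lambda>k. esym k y)) n"
    by (cases n) (simp_all add: distrib_right mult.assoc)
qed

text \<open>The constant term is fixed as 0 because \<open>psum 0\<close> would count the
  variables.\<close>

definition psum_fps :: "complex list \<Rightarrow> complex list \<Rightarrow> complex fps" where
  "psum_fps x y = Abs_fps (\<lambda>k. if k = 0 then 0 else psum k x y)"

text \<open>A new entry of \<open>x\<close> contributes a X / (1 - a X), which is X times the
  logarithmic derivative of its factor 1/(1 - a X); denominators are cleared.\<close>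

lemma psum_fps_Cons1:
  "(1 - fps_const a * fps_X) * psum_fps (a # x) y =
     (1 - fps_const a * fps_X) * psum_fps x y + fps_const a * fps_X"
proof (rule fps_ext)
  fix n
  show "fps_nth ((1 - fps_const a * fps_X) * psum_fps (a # x) y) n =
    fps_nth ((1 - fps_const a * fps_X) * psum_fps x y + fps_const a * fps_X) n"
    \<comment> \<open>Degrees 0 and 1 are separate: the constant term is exceptional and the extra
      summand a X sits in degree 1.\<close>
    by (cases n; cases "n - 1")
       (simp_all add: left_diff_distrib mult.assoc psum_fps_def psum_def algebra_simps)
qed

lemma psum_fps_Cons2:
  "(1 + fps_const a * fps_X) * psum_fps x (a # y) =
     (1 + fps_const a * fps_X) * psum_fps x y + fps_const a * fps_X"
proof (rule fps_ext)
  fix n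
  show "fps_nth ((1 + fps_const a * fps_X) * psum_fps x (a # y)) n =
    fps_nth ((1 + fps_const a * fps_X) * psum_fps x y + fps_const a * fps_X) n"
    by (cases n; cases "n - 1")
       (simp_all add: distrib_right mult.assoc psum_fps_def psum_def algebra_simps)
qed

text \<open>Logarithmic differentiation of the product formula for the generating function, one
  factor at a time: first the factors 1 + a X, then the factors 1/(1 - a X).\<close>

lemma fps_hsup_newton:
  "fps_X * fps_deriv (Abs_fps (\<lambda>k. hsup k x y)) = Abs_fps (\<lambda>k. hsup k x y) * psum_fps x y"
proof -
  have H: "Abs_fps (\<lambda>k. hsup k x y) = Abs_fps (\<lambda>k. hcomp k x) * Abs_fps (\<lambda>k. esym k y)" for x y
    by (rule fps_ext) (simp add: hsup_def fps_mult_nth)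
  have e: "fps_X * fps_deriv (Abs_fps (\<lambda>k. esym k y)) = Abs_fps (\<lambda>k. esym k y) * psum_fps [] y"
  proof (induction y)
    case Nil
    have "Abs_fps (\<lambda>k. esym k []) = 1" by (rule fps_ext) simp
    moreover have "psum_fps [] [] = 0" by (rule fps_ext) (simp add: psum_fps_def psum_def)
    ultimately show ?case by simp
  next
    case (Cons a y)
    let ?E = "Abs_fps (\<lambda>k. esym k y)" and ?c = "fps_const a * fps_X"
    have "fps_X * fps_deriv (Abs_fps (\<lambda>k. esym k (a # y))) =
        ?c * ?E + (1 + ?c) * (fps_X * fps_deriv ?E)"
      unfolding fps_esym_Cons by (simp add: algebra_simps)
    also have "\<dots> = ?E * ((1 + ?c) * psum_fps [] y + ?c)" unfolding Cons by (simp add: algebra_simps)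
    also have "\<dots> = ?E * ((1 + ?c) * psum_fps [] (a # y))" by (simp only: psum_fps_Cons2)
    finally show ?case unfolding fps_esym_Cons by (simp only: mult_ac)
  qed
  show ?thesis
  proof (induction x)
    case Nil
    have "Abs_fps (\<lambda>k. hcomp k []) = 1" by (rule fps_ext) simp
    then show ?case using e by (simp add: H)
  next
    case (Cons a x)
    let ?H = "Abs_fps (\<lambda>k. hsup k x y)" and ?H' = "Abs_fps (\<lambda>k. hsup k (a # x) y)"
      and ?c = "fps_const a * fps_X"
    have HH: "?H = (1 - ?c) * ?H'" unfolding H by (subst fps_hcomp_Cons[of x a]) (simp add: mult_ac)
    have "(1 - ?c) * (fps_X * fps_deriv ?H') = fps_X * fps_deriv ?H + ?c * ?H'"
      unfolding HH by (simp add: algebra_simps)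
    also have "\<dots> = ?H' * ((1 - ?c) * psum_fps x y + ?c)" unfolding Cons unfolding HH
      by (simp add: algebra_simps)
    also have "\<dots> = (1 - ?c) * (?H' * psum_fps (a # x) y)"
      unfolding psum_fps_Cons1[symmetric] by (simp only: mult_ac)
    finally have "(1 - ?c) * (fps_X * fps_deriv ?H') = (1 - ?c) * (?H' * psum_fps (a # x) y)" .
    \<comment> \<open>Power series over a field form a domain, so the nonzero factor 1 - a X
      cancels.\<close>
    moreover have "fps_nth (1 - ?c) 0 = 1" by simp
    then have "1 - ?c \<noteq> 0" by (metis fps_zero_nth zero_neq_one)
    ultimately show ?case by (simp only: mult_cancel_left) simp
  qed
qed

lemma hsup_newton:
  "of_nat (Suc n) * hsup (Suc n) x y = (\<Sum>i\<le>n. hsup i x y * psum (Suc n - i) x y)"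
proof -
  have "of_nat (Suc n) * hsup (Suc n) x y = fps_nth (fps_X * fps_deriv (Abs_fps (\<lambda>k. hsup k x y))) (Suc n)"
    by simp
  also have "\<dots> = (\<Sum>i=0..Suc n. hsup i x y * (if Suc n - i = 0 then 0 else psum (Suc n - i) x y))"
    unfolding fps_hsup_newton by (simp add: fps_mult_nth psum_fps_def)
  also have "\<dots> = (\<Sum>i\<le>n. hsup i x y * psum (Suc n - i) x y)"
    by (simp add: atMost_atLeast0)
  finally show ?thesis .
qed

lemma Lambda_sum:
  "(\<And>i. i \<in> A \<Longrightarrow> f i \<in> Lambda) \<Longrightarrow> (\<lambda>x y. \<Sum>i\<in>A. f i x y) \<in> Lambda"
  by (induction A rule: infinite_finite_induct) (auto intro: Lambda.intros)

lemma Lambda_prod: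
  "(\<And>i. i \<in> A \<Longrightarrow> f i \<in> Lambda) \<Longrightarrow> (\<lambda>x y. \<Prod>i\<in>A. f i x y) \<in> Lambda"
  by (induction A rule: infinite_finite_induct) (auto intro: Lambda.intros)

lemma Lambda_cmult: "f \<in> Lambda \<Longrightarrow> (\<lambda>x y. c * f x y) \<in> Lambda"
  by (rule Lambda.mult[OF Lambda.const])

text \<open>Newton's identity is solved for the highest term, dividing by \<open>k\<close>.\<close>

lemma hsup_in_Lambda: "hsup k \<in> Lambda"
proof (induction k rule: less_induct)
  case (less k)
  show ?case
  proof (cases k)
    case 0
    have "hsup k = (\<lambda>x y. 1)" using 0 by (simp add: hsup_def fun_eq_iff)
    then show ?thesis by (simp add: Lambda.const)
  next
    case (Suc n)
    have "hsup k = (\<lambda>x y. (1 / of_nat (Suc n)) * (\<Sum>i\<le>n. hsup i x y * psum (Suc n - i) x y))"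
      unfolding Suc hsup_newton[symmetric] by (simp add: fun_eq_iff del: of_nat_Suc)
    moreover have "\<dots> \<in> Lambda"
      using less Suc by (intro Lambda_cmult Lambda_sum Lambda.mult Lambda.power_sum) auto
    ultimately show ?thesis by simp
  qed
qed

lemma hpar_in_Lambda: "hpar k a \<in> Lambda"
proof -
  have "(\<lambda>x y. \<Sum>i = 1..nat k. ((-1) ^ (nat k - i) * esym (nat k - i) (map a [1..k - 1])) * hsup i x y) \<in> Lambda"
    by (intro Lambda_sum Lambda_cmult hsup_in_Lambda)
  then show ?thesis by (cases "k < 0"; cases "k = 0") (auto simp: hpar_def[abs_def] Lambda.const)
qed

lemma schur_par_in_Lambda: "schur_par a \<mu> \<in> Lambda"
  unfolding schur_par_def[abs_def] detN_def
  by (intro Lambda_sum Lambda_cmult Lambda_prod hpar_in_Lambda)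

text \<open>Elements of Lambda as polynomials in the power sums, regarded as independent variables.\<close>

inductive_set poly_fun :: "((nat \<Rightarrow> complex) \<Rightarrow> complex) set" where
  const: "(\<lambda>p. c) \<in> poly_fun"
| var: "k \<ge> 1 \<Longrightarrow> (\<lambda>p. p k) \<in> poly_fun"
| add: "F \<in> poly_fun \<Longrightarrow> G \<in> poly_fun \<Longrightarrow> (\<lambda>p. F p + G p) \<in> poly_fun"
| mult: "F \<in> poly_fun \<Longrightarrow> G \<in> poly_fun \<Longrightarrow> (\<lambda>p. F p * G p) \<in> poly_fun"

lemma Lambda_poly_fun:
  "f \<in> Lambda \<Longrightarrow> \<exists>F\<in>poly_fun. \<forall>x y. f x y = F (\<lambda>k. psum k x y)"
proof (induction rule: Lambda.induct)
  case (const c)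
  show ?case by (rule bexI[OF _ poly_fun.const[of c]]) simp
next
  case (power_sum k)
  then show ?case by (intro bexI[OF _ poly_fun.var[of k]]) auto
next
  case (add f g)
  then obtain F G where "F \<in> poly_fun" "G \<in> poly_fun" "\<forall>x y. f x y = F (\<lambda>k. psum k x y)"
    "\<forall>x y. g x y = G (\<lambda>k. psum k x y)" by blast
  then show ?case by (intro bexI[OF _ poly_fun.add[of F G]]) auto
next
  case (mult f g)
  then obtain F G where "F \<in> poly_fun" "G \<in> poly_fun" "\<forall>x y. f x y = F (\<lambda>k. psum k x y)"
    "\<forall>x y. g x y = G (\<lambda>k. psum k x y)" by blast
  then show ?case by (intro bexI[OF _ poly_fun.mult[of F G]]) auto
qed

lemma poly_fun_cong:
  assumes "F \<in> poly_fun" "\<And>k. k \<ge> 1 \<Longrightarrow> p k = q k"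
  shows "F p = F q"
  using assms by (induction rule: poly_fun.induct) auto

text \<open>Allows the Frobenius coordinates to be exchanged for another point with the same power
  sums of positive degree, even when the number of coordinates differs.\<close>

lemma Lambda_cong:
  assumes "f \<in> Lambda" "\<And>k. k \<ge> 1 \<Longrightarrow> psum k x y = psum k x' y'"
  shows "f x y = f x' y'"
  using Lambda_poly_fun[OF assms(1)] poly_fun_cong assms(2) by fastforce

section \<open>Power sums at Frobenius coordinates\<close>

lemma row_antimono:
  assumes "young \<nu>" "1 \<le> i" "i \<le> k"
  shows "row \<nu> k \<le> row \<nu> i"
proof (cases "k \<le> length \<nu> \<and> i < k")
  case True
  then have "\<nu> ! (i - 1) \<ge> \<nu> ! (k - 1)"
    using assms by (intro sorted_wrt_nth_less[of "(\<ge>)" \<nu>]) (auto simp: young_def)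
  then show ?thesis using True assms by (simp add: row_def)
next
  case False
  then show ?thesis using assms by (auto simp: row_def le_less)
qed

text \<open>Turns the cardinalities \<open>diag\<close> and \<open>col\<close> into thresholds: the
  rows they count form an initial segment.\<close>

lemma down_closed_eq_atLeastAtMost:
  fixes A :: "nat set"
  assumes "finite A" "0 \<notin> A" "\<And>i k. i \<in> A \<Longrightarrow> 1 \<le> k \<Longrightarrow> k \<le> i \<Longrightarrow> k \<in> A"
  shows "A = {1..card A}"
proof (cases "A = {}")
  case False
  have "A = {1..Max A}"
  proof
    show "A \<subseteq> {1..Max A}" using assms(1,2) by (auto simp: Suc_le_eq intro: gr0I)
    show "{1..Max A} \<subseteq> A" using assms(3)[OF Max_in[OF assms(1) False]] by auto
  qed
  then show ?thesis by (metis card_atLeastAtMost diff_Suc_1)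
qed simp

lemma le_diag_iff:
  assumes "young \<nu>" "1 \<le> i"
  shows "i \<le> diag \<nu> \<longleftrightarrow> i \<le> row \<nu> i"
proof -
  let ?A = "{i. 1 \<le> i \<and> i \<le> length \<nu> \<and> i \<le> row \<nu> i}"
  have "finite ?A" by (rule finite_subset[of _ "{..length \<nu>}"]) auto
  moreover have "k \<in> ?A" if "i \<in> ?A" "1 \<le> k" "k \<le> i" for i k
    using row_antimono[OF assms(1) that(2,3)] that by auto
  ultimately have "?A = {1..diag \<nu>}"
    unfolding diag_def by (intro down_closed_eq_atLeastAtMost) auto
  then have "i \<in> ?A \<longleftrightarrow> i \<in> {1..diag \<nu>}" by simp
  then show ?thesis using assms(2) by (auto simp: row_def split: if_splits)
qed

lemma le_col_iff:
  assumes "young \<nu>" "1 \<le> i" "1 \<le> j"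
  shows "i \<le> col \<nu> j \<longleftrightarrow> j \<le> row \<nu> i"
proof -
  let ?A = "{i. 1 \<le> i \<and> i \<le> length \<nu> \<and> j \<le> row \<nu> i}"
  have "finite ?A" by (rule finite_subset[of _ "{..length \<nu>}"]) auto
  moreover have "k \<in> ?A" if "i \<in> ?A" "1 \<le> k" "k \<le> i" for i k
    using row_antimono[OF assms(1) that(2,3)] that by auto
  ultimately have "?A = {1..col \<nu> j}"
    unfolding col_def by (intro down_closed_eq_atLeastAtMost) auto
  then have "i \<in> ?A \<longleftrightarrow> i \<in> {1..col \<nu> j}" by simp
  then show ?thesis using assms(2,3) by (auto simp: row_def split: if_splits)
qed

lemma cells_eq: "cells \<nu> = {(i, j). 1 \<le> i \<and> 1 \<le> j \<and> j \<le> row \<nu> i}"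
  by (auto simp: cells_def row_def split: if_splits)

text \<open>Contents increase by one along a row, so each row telescopes; empty rows up to
  \<open>N\<close> contribute 0.\<close>

lemma sum_content_diff_rows:
  fixes g :: "int \<Rightarrow> complex"
  assumes "length \<nu> \<le> N"
  shows "(\<Sum>(i, j)\<in>cells \<nu>. g (int j - int i) - g (int j - int i - 1)) =
    (\<Sum>i=1..N. g (int (row \<nu> i) - int i) - g (- int i))"
proof -
  have inner: "(\<Sum>j=1..r. g (int j - int i) - g (int j - int i - 1)) = g (int r - int i) - g (- int i)" for i r
    by (induction r) (auto simp: algebra_simps)
  have "cells \<nu> = (SIGMA i:{1..N}. {1..row \<nu> i})"
    using assms by (auto simp: cells_eq row_def split: if_splits)
  then show ?thesis by (simp only: inner sum.Sigma[symmetric] finite_atLeastAtMost ball_triv simp_thms)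
qed

text \<open>The same sum taken along diagonal hooks: an arm telescopes down to \<open>g (-1)\<close>
  and the leg telescopes from there, so the two occurrences of \<open>g (-1)\<close> cancel.\<close>

lemma sum_content_diff_hooks:
  fixes g :: "int \<Rightarrow> complex"
  assumes y: "young \<nu>"
  shows "(\<Sum>(i, j)\<in>cells \<nu>. g (int j - int i) - g (int j - int i - 1)) =
    (\<Sum>i=1..diag \<nu>. g (int (row \<nu> i) - int i) - g (int i - int (col \<nu> i) - 1))"
proof -
  let ?G = "\<lambda>(i, j). g (int j - int i) - g (int j - int i - 1)"
  let ?U = "SIGMA i:{1..diag \<nu>}. {i..row \<nu> i}" and ?L = "SIGMA j:{1..diag \<nu>}. {j<..col \<nu> j}"
  have arm: "(\<Sum>j=i..i+m. g (int j - int i) - g (int j - int i - 1)) = g (int m) - g (-1)" for i m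
    by (induction m) (auto simp: algebra_simps)
  have leg: "(\<Sum>i\<in>{j<..j+m}. g (int j - int i) - g (int j - int i - 1)) = g (-1) - g (- int m - 1)" for j m
  proof (induction m)
    case (Suc m)
    have "{j<..j + Suc m} = insert (j + Suc m) {j<..j+m}" by auto
    moreover have "int j - int (j + Suc m) = - int m - 1" "int j - int (j + Suc m) - 1 = - int (Suc m) - 1"
      by simp_all
    moreover have "g (- 1 - int m) = g (- int m - 1)" by (rule arg_cong[where f = g]) simp
    ultimately show ?case using Suc by simp
  qed simp
  \<comment> \<open>The arms contain the diagonal boxes and the legs do not. Legs are indexed by
    their column first, hence the swap.\<close>
  have cells: "cells \<nu> = ?U \<union> prod.swap ` ?L"
  proof (intro set_eqI iffI)
    fix c assume c: "c \<in> cells \<nu>"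
    obtain i j where ij: "c = (i, j)" by (cases c)
    have c': "1 \<le> i" "1 \<le> j" "j \<le> row \<nu> i" using c ij by (auto simp: cells_eq)
    show "c \<in> ?U \<union> prod.swap ` ?L"
    proof (cases "i \<le> j")
      case True
      then show ?thesis using c' le_diag_iff[OF y, of i] ij by auto
    next
      case False
      then have "j \<le> diag \<nu>" using c' le_diag_iff[OF y, of j] row_antimono[OF y, of j i] by auto
      then have "(j, i) \<in> ?L" using c' False le_col_iff[OF y, of i j] by auto
      then show ?thesis using ij by force
    qed
  next
    fix c assume "c \<in> ?U \<union> prod.swap ` ?L"
    then show "c \<in> cells \<nu>" using le_col_iff[OF y] by (auto simp: cells_eq)
  qed
  have "(\<Sum>c\<in>cells \<nu>. ?G c) = (\<Sum>c\<in>?U. ?G c) + (\<Sum>c\<in>prod.swap ` ?L. ?G c)"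
    unfolding cells by (intro sum.union_disjoint) auto
  also have "(\<Sum>c\<in>?U. ?G c) = (\<Sum>i=1..diag \<nu>. \<Sum>j=i..row \<nu> i. g (int j - int i) - g (int j - int i - 1))"
    by (subst sum.Sigma) auto
  also have "\<dots> = (\<Sum>i=1..diag \<nu>. g (int (row \<nu> i) - int i) - g (-1))"
  proof (intro sum.cong refl)
    fix i assume "i \<in> {1..diag \<nu>}"
    then have "i \<le> row \<nu> i" using le_diag_iff[OF y, of i] by auto
    then show "(\<Sum>j=i..row \<nu> i. g (int j - int i) - g (int j - int i - 1)) = g (int (row \<nu> i) - int i) - g (-1)"
      using arm[of i "row \<nu> i - i"] by (simp add: of_nat_diff)
  qed
  also have "(\<Sum>c\<in>prod.swap ` ?L. ?G c) = (\<Sum>(j, i)\<in>?L. ?G (i, j))"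
    by (subst sum.reindex) (auto simp: o_def case_prod_unfold)
  also have "\<dots> = (\<Sum>j=1..diag \<nu>. \<Sum>i\<in>{j<..col \<nu> j}. g (int j - int i) - g (int j - int i - 1))"
    by (subst sum.Sigma) auto
  also have "\<dots> = (\<Sum>j=1..diag \<nu>. g (-1) - g (int j - int (col \<nu> j) - 1))"
  proof (intro sum.cong refl)
    fix j assume "j \<in> {1..diag \<nu>}"
    then have "j \<le> col \<nu> j" using le_diag_iff[OF y, of j] le_col_iff[OF y, of j j] by auto
    then show "(\<Sum>i\<in>{j<..col \<nu> j}. g (int j - int i) - g (int j - int i - 1)) = g (-1) - g (int j - int (col \<nu> j) - 1)"
      using leg[of j "col \<nu> j - j"] by (simp add: of_nat_diff)
  qed
  finally show ?thesis by (simp add: sum.distrib[symmetric])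
qed

text \<open>A coordinate \<open>v\<close> of \<open>y\<close> acts as the coordinate
  \<open>- v\<close> of \<open>x\<close> counted negatively. At \<open>k = 0\<close> the truncated
  exponent would spoil this.\<close>

lemma minus_power_odd_sign:
  "k \<ge> 1 \<Longrightarrow> (- v) ^ k = - ((-1) ^ (k - 1) * v ^ k)" for v :: complex
  by (cases k) (auto simp: power_minus[of v])

lemma psum_frob:
  assumes "young \<nu>" "length \<nu> \<le> N" "k \<ge> 1"
  shows "psum k (frob_x \<nu>) (frob_y \<nu>) =
    (\<Sum>i=1..N. (of_nat (row \<nu> i) - of_nat i + 1/2) ^ k - (1/2 - of_nat i) ^ k)"
proof -
  \<comment> \<open>Half-integer shift of the content: an arm end has content p and gives p + 1/2,
    while one step past a leg end has content -q - 1 and gives -(q + 1/2).\<close>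
  define g :: "int \<Rightarrow> complex" where "g c = (of_int c + 1/2) ^ k" for c
  have neg: "(-1) ^ (k - 1) * v ^ k = - ((- v) ^ k)" for v :: complex
    using assms(3) by (simp add: minus_power_odd_sign)
  have gy: "(-1) ^ (k - 1) * (of_int (int (col \<nu> i) - int i) + 1/2) ^ k = - g (int i - int (col \<nu> i) - 1)" for i
    unfolding neg g_def by (intro arg_cong[where f = uminus] arg_cong[where f = "\<lambda>z. z ^ k"]) (simp add: field_simps)
  have "psum k (frob_x \<nu>) (frob_y \<nu>) =
      (\<Sum>i=1..diag \<nu>. g (int (row \<nu> i) - int i)) +
      (\<Sum>i=1..diag \<nu>. (-1) ^ (k - 1) * (of_int (int (col \<nu> i) - int i) + 1/2) ^ k)"
    unfolding psum_def frob_x_def frob_y_def g_def sum_distrib_left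
    by (simp only: map_map o_def sum_list_distinct_conv_sum_set[OF distinct_upt] set_upt sum_distrib_left
        Suc_eq_plus1[symmetric] atLeastLessThanSuc_atLeastAtMost)
  also have "\<dots> = (\<Sum>i=1..diag \<nu>. g (int (row \<nu> i) - int i) - g (int i - int (col \<nu> i) - 1))"
    unfolding gy by (simp add: sum_negf sum_subtractf)
  also have "\<dots> = (\<Sum>i=1..N. g (int (row \<nu> i) - int i) - g (- int i))"
    using sum_content_diff_hooks[OF assms(1), of g] sum_content_diff_rows[OF assms(2), of g] by simp
  finally show ?thesis by (simp add: g_def algebra_simps)
qed

section \<open>Divided differences\<close>

definition divdiff :: "complex set \<Rightarrow> (complex \<Rightarrow> complex) \<Rightarrow> complex" where
  "divdiff S f = (\<Sum>u\<in>S. f u / (\<Prod>w\<in>S - {u}. u - w))"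

lemma divdiff_cong: "(\<And>u. u \<in> S \<Longrightarrow> f u = g u) \<Longrightarrow> divdiff S f = divdiff S g"
  by (simp add: divdiff_def)

lemma divdiff_add: "divdiff S (\<lambda>u. f u + g u) = divdiff S f + divdiff S g"
  by (simp add: divdiff_def sum.distrib add_divide_distrib)

lemma divdiff_cmult: "divdiff S (\<lambda>u. c * f u) = c * divdiff S f"
  by (simp add: divdiff_def sum_distrib_left)

lemma divdiff_sum: "divdiff S (\<lambda>u. \<Sum>i\<in>A. f i u) = (\<Sum>i\<in>A. divdiff S (f i))"
  by (simp add: divdiff_def sum_divide_distrib sum.swap[of _ A])

text \<open>The factor \<open>u - a\<close> kills the term at the new node and cancels the new
  denominator in all other terms.\<close>

lemma divdiff_insert:
  assumes "finite S" "a \<notin> S"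
  shows "divdiff (insert a S) (\<lambda>u. (u - a) * f u) = divdiff S f"
proof -
  have "divdiff (insert a S) (\<lambda>u. (u - a) * f u) =
      (\<Sum>u\<in>S. (u - a) * f u / (\<Prod>w\<in>insert a S - {u}. u - w))"
    using assms by (simp add: divdiff_def)
  also have "\<dots> = divdiff S f"
    unfolding divdiff_def
  proof (intro sum.cong refl)
    fix u assume u: "u \<in> S"
    then have "insert a S - {u} = insert a (S - {u})" using assms by auto
    then have "(\<Prod>w\<in>insert a S - {u}. u - w) = (u - a) * (\<Prod>w\<in>S - {u}. u - w)"
      using assms by simp
    then show "(u - a) * f u / (\<Prod>w\<in>insert a S - {u}. u - w) = f u / (\<Prod>w\<in>S - {u}. u - w)"
      using u assms by auto
  qed
  finally show ?thesis .
qed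

text \<open>Write \<open>b - a\<close> as \<open>(u - a) - (u - b)\<close> and remove one node from
  each part. The two remaining values agree: both vanish by induction, or both are 1 when a single
  node is left.\<close>

lemma divdiff_const:
  "finite S \<Longrightarrow> card S \<ge> 2 \<Longrightarrow> divdiff S (\<lambda>u. 1) = 0"
proof (induction "card S" arbitrary: S rule: less_induct)
  case less
  obtain a b where ab: "a \<in> S" "b \<in> S" "a \<noteq> b"
    using less.prems by (metis card_le_Suc0_iff_eq not_less_eq_eq numeral_2_eq_2)
  have rem: "divdiff S (\<lambda>u. u - c) = divdiff (S - {c}) (\<lambda>u. 1)" if "c \<in> S" for c
    using divdiff_insert[of "S - {c}" c "\<lambda>u. 1"] that less.prems by (simp add: insert_absorb)
  have eq: "divdiff (S - {a}) (\<lambda>u. 1) = divdiff (S - {b}) (\<lambda>u. 1)"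
  proof (cases "card S \<ge> 3")
    case True
    then show ?thesis using less ab by auto
  next
    case False
    then have "card S = 2" using less.prems by simp
    then have "S = {a, b}" using ab by (auto simp: card_2_iff)
    then have "S - {a} = {b}" "S - {b} = {a}" using ab by auto
    then show ?thesis by (simp add: divdiff_def)
  qed
  have "(b - a) * divdiff S (\<lambda>u. 1) = divdiff S (\<lambda>u. (u - a) + (-1) * (u - b))"
    by (simp flip: divdiff_cmult)
  also have "\<dots> = 0" unfolding divdiff_add divdiff_cmult rem[OF ab(1)] rem[OF ab(2)] eq by simp
  finally show ?case using ab by simp
qed

text \<open>Splitting u^(r+1) into (u - a) u^r and a u^r reproduces the recurrence
  \<open>hcomp_Suc_Cons\<close>.\<close>

lemma divdiff_power:
  "distinct x \<Longrightarrow> divdiff (set x) (\<lambda>u. u ^ r) =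
     (if r + 1 < length x then 0 else hcomp (r + 1 - length x) x)"
proof (induction x arbitrary: r)
  case Nil
  then show ?case by (simp add: divdiff_def)
next
  case (Cons a x)
  show ?case
  proof (induction r)
    case 0
    show ?case
    proof (cases x)
      case Nil
      then show ?thesis by (simp add: divdiff_def)
    next
      case (Cons b x')
      then have "card (set (a # x)) \<ge> 2" using \<open>distinct (a # x)\<close> by (simp add: distinct_card)
      then show ?thesis using divdiff_const[of "set (a # x)"] Cons by simp
    qed
  next
    case (Suc r)
    have "divdiff (set (a # x)) (\<lambda>u. u ^ Suc r) =
        divdiff (set (a # x)) (\<lambda>u. (u - a) * u ^ r + a * u ^ r)"
      by (simp add: algebra_simps)
    also have "\<dots> = divdiff (set x) (\<lambda>u. u ^ r) + a * divdiff (set (a # x)) (\<lambda>u. u ^ r)"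
      using Cons.prems by (simp add: divdiff_add divdiff_cmult divdiff_insert)
    also have "\<dots> = (if Suc r + 1 < length (a # x) then 0 else hcomp (Suc r + 1 - length (a # x)) (a # x))"
    proof -
      consider "r + 1 < length x" | "r + 1 = length x" | "length x \<le> r" by linarith
      then show ?thesis
      proof cases
        case 3
        then have "r + 1 - length x = Suc (r - length x)" by simp
        then show ?thesis using 3 Cons.IH[of r] Cons.prems Suc
          by (simp add: hcomp_Suc_Cons del: hcomp.simps)
      qed (use Cons.IH[of r] Cons.prems Suc in \<open>simp_all del: hcomp.simps\<close>)
    qed
    finally show ?case .
  qed
qed

text \<open>Lower powers vanish, and the power of exponent \<open>length x - 1\<close> has divided
  difference \<open>hcomp 0 x = 1\<close>.\<close>

lemma divdiff_poly:
  assumes "distinct x" "degree p < length x"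
  shows "divdiff (set x) (poly p) = coeff p (length x - 1)"
proof -
  have "divdiff (set x) (poly p) = (\<Sum>r<length x. coeff p r * divdiff (set x) (\<lambda>u. u ^ r))"
  proof -
    have "poly p u = (\<Sum>r<length x. coeff p r * u ^ r)" for u
      unfolding poly_altdef using assms(2)
      by (intro sum.mono_neutral_left) (auto simp: coeff_eq_0)
    then have "divdiff (set x) (poly p) = divdiff (set x) (\<lambda>u. \<Sum>r<length x. coeff p r * u ^ r)"
      by (intro divdiff_cong) simp
    then show ?thesis by (simp add: divdiff_sum divdiff_cmult)
  qed
  also have "\<dots> = (\<Sum>r<length x. if r = length x - 1 then coeff p r else 0)"
    using assms(1) by (intro sum.cong) (auto simp: divdiff_power)
  also have "\<dots> = coeff p (length x - 1)" using assms(2) by (simp add: sum.delta)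
  finally show ?thesis .
qed

section \<open>Supersymmetric complete functions as divided differences\<close>

lemma esym_eq_0: "length y < j \<Longrightarrow> esym j y = 0"
  by (induction y arbitrary: j) auto

text \<open>The sign \<open>s\<close> lets one expansion serve both the product over
  \<open>y\<close> (with 1) and the product over the parameters (with -1).\<close>

lemma prod_list_esym:
  "(\<Prod>v\<leftarrow>y. u + s * v) = (\<Sum>j\<le>length y. s ^ j * esym j y * u ^ (length y - j))"
proof (induction y)
  case (Cons a y)
  have "(\<Sum>j\<le>length (a # y). s ^ j * esym j (a # y) * u ^ (length (a # y) - j)) =
     (\<Sum>j\<le>Suc (length y). s ^ j * esym j y * u ^ (Suc (length y) - j)) +
     (\<Sum>j\<le>Suc (length y). s ^ j * (if j = 0 then 0 else a * esym (j - 1) y) * u ^ (Suc (length y) - j))"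
    by (simp only: esym.simps length_Cons distrib_left distrib_right sum.distrib)
  also have "(\<Sum>j\<le>Suc (length y). s ^ j * esym j y * u ^ (Suc (length y) - j)) =
     u * (\<Sum>j\<le>length y. s ^ j * esym j y * u ^ (length y - j))"
    by (simp add: esym_eq_0 sum_distrib_left Suc_diff_le mult_ac)
  also have "(\<Sum>j\<le>Suc (length y). s ^ j * (if j = 0 then 0 else a * esym (j - 1) y) * u ^ (Suc (length y) - j)) =
     s * a * (\<Sum>j\<le>length y. s ^ j * esym j y * u ^ (length y - j))"
    by (simp only: sum.atMost_Suc_shift) (simp add: sum_distrib_left mult_ac)
  finally show ?case using Cons by (simp add: algebra_simps)
qed simp

text \<open>Expand the product over \<open>y\<close> and apply \<open>divdiff_power\<close> to each
  power. Equal lengths make the degrees come out as \<open>Suc r - j\<close>.\<close>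

lemma divdiff_hsup:
  assumes "distinct x" "length y = length x"
  shows "divdiff (set x) (\<lambda>u. u ^ r * (\<Prod>v\<leftarrow>y. u + v)) = hsup (Suc r) x y"
proof -
  let ?N = "length x"
  have "divdiff (set x) (\<lambda>u. u ^ r * (\<Prod>v\<leftarrow>y. u + v)) =
      divdiff (set x) (\<lambda>u. \<Sum>j\<le>?N. esym j y * u ^ (r + ?N - j))"
  proof (rule divdiff_cong)
    fix u
    have "u ^ r * (\<Prod>v\<leftarrow>y. u + v) = (\<Sum>j\<le>?N. u ^ r * (esym j y * u ^ (?N - j)))"
      using prod_list_esym[of u 1 y] assms by (simp add: sum_distrib_left)
    also have "\<dots> = (\<Sum>j\<le>?N. esym j y * u ^ (r + ?N - j))"
    proof (intro sum.cong refl)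
      fix j assume "j \<in> {..?N}"
      then have "r + ?N - j = r + (?N - j)" by simp
      then show "u ^ r * (esym j y * u ^ (?N - j)) = esym j y * u ^ (r + ?N - j)"
        by (simp only: power_add) simp
    qed
    finally show "u ^ r * (\<Prod>v\<leftarrow>y. u + v) = (\<Sum>j\<le>?N. esym j y * u ^ (r + ?N - j))" .
  qed
  also have "\<dots> = (\<Sum>j\<le>?N. esym j y * (if j \<le> Suc r then hcomp (Suc r - j) x else 0))"
    unfolding divdiff_sum divdiff_cmult divdiff_power[OF assms(1)]
    by (intro sum.cong refl arg_cong2[where f = "(*)"]) auto
  \<comment> \<open>The range of \<open>j\<close> is first enlarged, where \<open>esym\<close>
    vanishes, and then cut to \<open>Suc r\<close>, where the conditional vanishes.\<close>
  also have "\<dots> = (\<Sum>j\<le>?N + Suc r. esym j y * (if j \<le> Suc r then hcomp (Suc r - j) x else 0))"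
    using assms(2) by (intro sum.mono_neutral_left) (auto simp: esym_eq_0)
  also have "\<dots> = (\<Sum>j\<le>Suc r. esym j y * hcomp (Suc r - j) x)"
    by (rule sum.mono_neutral_cong_right) auto
  also have "\<dots> = hsup (Suc r) x y"
    unfolding hsup_def atMost_atLeast0
    by (subst sum.atLeastAtMost_rev) (auto intro!: sum.cong simp: mult.commute)
  finally show ?thesis .
qed

text \<open>The coefficients in \<open>hpar\<close> are those of the monic polynomial with roots
  c_1, ..., c_(m-1), so \<open>divdiff_hsup\<close> applies by linearity.\<close>

lemma divdiff_hpar:
  assumes "distinct x" "length y = length x" "m \<ge> 1"
  shows "hpar (int m) c x y =
    divdiff (set x) (\<lambda>u. (\<Prod>l=1..<m. u - c (int l)) * (\<Prod>v\<leftarrow>y. u + v))"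
proof -
  obtain n where n: "m = Suc n" using assms(3) by (cases m) auto
  let ?c = "map c [1..int n]"
  have len: "length ?c = n" by simp
  have prod: "(\<Prod>l=1..<m. u - c (int l)) = (\<Sum>j\<le>n. (-1) ^ j * esym j ?c * u ^ (n - j))" for u
  proof -
    have "(\<Prod>v\<leftarrow>?c. u + (-1) * v) = (\<Prod>l\<in>{1..int n}. u - c l)"
      by (simp add: o_def prod.distinct_set_conv_list[symmetric])
    also have "\<dots> = (\<Prod>l=1..<m. u - c (int l))"
      by (rule prod.reindex_bij_witness[of _ int nat]) (auto simp: n)
    finally show ?thesis using prod_list_esym[of u "-1" ?c] by (simp only: len)
  qed
  have "hpar (int m) c x y = (\<Sum>i=1..m. (-1) ^ (m - i) * esym (m - i) ?c * hsup i x y)"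
  proof -
    have "int m - 1 = int n" by (simp add: n)
    then show ?thesis using assms(3) by (simp add: hpar_def)
  qed
  also have "\<dots> = (\<Sum>j\<le>n. (-1) ^ j * esym j ?c * hsup (m - j) x y)"
    by (rule sum.reindex_bij_witness[of _ "\<lambda>j. m - j" "\<lambda>i. m - i"]) (auto simp: n)
  also have "\<dots> = (\<Sum>j\<le>n. (-1) ^ j * esym j ?c * divdiff (set x) (\<lambda>u. u ^ (n - j) * (\<Prod>v\<leftarrow>y. u + v)))"
    by (intro sum.cong refl) (simp add: divdiff_hsup[OF assms(1,2)] n Suc_diff_le)
  also have "\<dots> = divdiff (set x) (\<lambda>u. (\<Prod>l=1..<m. u - c (int l)) * (\<Prod>v\<leftarrow>y. u + v))"
    unfolding divdiff_cmult[symmetric] divdiff_sum[symmetric] prod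
    by (intro divdiff_cong) (simp add: sum_distrib_right mult.assoc)
  finally show ?thesis .
qed

section \<open>Falling factorials and the factorisation of the Jacobi-Trudi matrix\<close>

definition ffact :: "complex \<Rightarrow> nat \<Rightarrow> complex" where
  "ffact z b = (\<Prod>s<b. z - of_nat s)"

lemma ffact_Suc: "ffact z (Suc b) = ffact z b * (z - of_nat b)"
  by (simp add: ffact_def)

lemma ffact_of_nat_eq_0: "n < b \<Longrightarrow> ffact (of_nat n) b = 0"
  unfolding ffact_def by (rule prod_zero) auto

lemma monic_linear_product:
  fixes f :: "'a \<Rightarrow> complex"
  shows "degree (\<Prod>s\<in>A. [:f s, 1:]) = card A" "lead_coeff (\<Prod>s\<in>A. [:f s, 1:]) = 1"
proof -
  show "degree (\<Prod>s\<in>A. [:f s, 1:]) = card A" by (simp add: degree_prod_eq_sum_degree)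
  show "lead_coeff (\<Prod>s\<in>A. [:f s, 1:]) = 1" unfolding lead_coeff_prod by simp
qed

text \<open>The special parameters enter here. With z = u + N - 1/2 all linear factors become z - s
  for integers s, and they regroup into a falling factorial that carries \<open>r\<close> and
  \<open>j\<close> and a product that carries only \<open>k\<close>.\<close>

lemma hpar_half_divdiff:
  assumes x: "distinct x" "length x = N" and k: "k \<in> {1..N}" and j: "j \<in> {1..N}"
  shows "hpar (int r - int j + int k) (shift (1 - int k) a_half) x (map (\<lambda>i. of_nat i - 1/2) [1..<N+1]) =
    divdiff (set x) (\<lambda>u. ffact (u + of_nat N - 1/2) (r + N - j) *
      (\<Prod>s\<in>{N-k+1..<N}. u + of_nat N - 1/2 - of_nat s))"
proof -
  let ?y = "map (\<lambda>i. of_nat i - 1/2 :: complex) [1..<N+1]"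
  let ?b = "r + N - j"
  let ?w = "\<lambda>u s. u + of_nat N - 1/2 - of_nat s :: complex"
  show ?thesis
  proof (cases "r + k > j")
    case True
    define m where "m = r + k - j"
    have m: "m \<ge> 1" "int r - int j + int k = int m" "?b = N - k + m" using True k j by (auto simp: m_def)
    have "hpar (int m) (shift (1 - int k) a_half) x ?y =
        divdiff (set x) (\<lambda>u. (\<Prod>l=1..<m. u - shift (1 - int k) a_half (int l)) * (\<Prod>v\<leftarrow>?y. u + v))"
      using x m by (intro divdiff_hpar) auto
    also have "\<dots> = divdiff (set x) (\<lambda>u. ffact (u + of_nat N - 1/2) ?b * (\<Prod>s\<in>{N-k+1..<N}. ?w u s))"
    proof (rule divdiff_cong)
      fix u
      \<comment> \<open>The shifted parameter at l is l - k + 1/2, so s = l + N - k.\<close>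
      have "(\<Prod>l=1..<m. u - shift (1 - int k) a_half (int l)) = (\<Prod>s\<in>{N-k+1..<?b}. ?w u s)"
        by (rule prod.reindex_bij_witness[of _ "\<lambda>s. s - (N - k)" "\<lambda>l. l + (N - k)"])
           (use k m in \<open>auto simp: shift_def a_half_def of_nat_diff algebra_simps\<close>)
      moreover have "(\<Prod>v\<leftarrow>?y. u + v) = (\<Prod>s<N. ?w u s)"
      proof -
        have "(\<Prod>v\<leftarrow>?y. u + v) = (\<Prod>i\<in>{1..<N+1}. u + (of_nat i - 1/2))"
          by (simp only: map_map o_def prod.distinct_set_conv_list[OF distinct_upt, symmetric] set_upt)
        also have "\<dots> = (\<Prod>s<N. ?w u s)"
          by (rule prod.reindex_bij_witness[of _ "\<lambda>s. N - s" "\<lambda>i. N - i"])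
             (auto simp: of_nat_diff algebra_simps)
        finally show ?thesis .
      qed
      moreover have "(\<Prod>s<N. ?w u s) = (\<Prod>s<N-k+1. ?w u s) * (\<Prod>s\<in>{N-k+1..<N}. ?w u s)"
        using k by (subst prod.union_disjoint[symmetric]) (auto intro!: prod.cong)
      moreover have "ffact (u + of_nat N - 1/2) ?b = (\<Prod>s<N-k+1. ?w u s) * (\<Prod>s\<in>{N-k+1..<?b}. ?w u s)"
        unfolding ffact_def using m
        by (subst prod.union_disjoint[symmetric]) (auto intro!: prod.cong)
      ultimately show "(\<Prod>l=1..<m. u - shift (1 - int k) a_half (int l)) * (\<Prod>v\<leftarrow>?y. u + v) =
          ffact (u + of_nat N - 1/2) ?b * (\<Prod>s\<in>{N-k+1..<N}. ?w u s)" by simp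
    qed
    finally show ?thesis by (simp only: m)
  next
    case False
    \<comment> \<open>The left side is now 0 or 1 by the conventions for \<open>hpar\<close>. The
      right side is the divided difference of a monic polynomial of degree at most N - 1, hence its
      coefficient at u^(N-1).\<close>
    let ?P = "\<lambda>A. \<Prod>s\<in>A. [:of_nat N - 1/2 - of_nat s, 1:] :: complex poly"
    define p where "p = ?P {..<?b} * ?P {N-k+1..<N}"
    have lc: "lead_coeff p = 1"
      unfolding p_def by (simp only: lead_coeff_mult monic_linear_product(2) mult_1)
    have "degree p = ?b + (k - 1)"
      unfolding p_def by (subst degree_mult_eq) (use k in \<open>auto simp: monic_linear_product(1) degree_prod_eq_sum_degree\<close>)
    then have deg: "degree p = N - 1 + (r + k) - j" using k j by simp
    have "divdiff (set x) (\<lambda>u. ffact (u + of_nat N - 1/2) ?b * (\<Prod>s\<in>{N-k+1..<N}. ?w u s)) =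
        divdiff (set x) (poly p)"
      by (intro divdiff_cong) (simp add: p_def ffact_def poly_prod algebra_simps)
    also have "\<dots> = coeff p (N - 1)" using x deg False k j by (subst divdiff_poly) auto
    also have "\<dots> = (if r + k = j then 1 else 0)"
    proof (cases "r + k = j")
      case True
      then have "degree p = N - 1" using deg by simp
      then show ?thesis using lc True by simp
    next
      case False
      then have "degree p < N - 1" using deg \<open>\<not> r + k > j\<close> j k by auto
      then show ?thesis using False by (simp add: coeff_eq_0)
    qed
    also have "\<dots> = hpar (int r - int j + int k) (shift (1 - int k) a_half) x ?y"
      using False by (auto simp: hpar_def)
    finally show ?thesis by simp
  qed
qed

text \<open>For row lengths \<open>n\<close> of \<open>\<nu>\<close> and \<open>m\<close> of \<open>\<mu>\<close> this is the numerator of the shifted Schur function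
  of \<open>\<mu>\<close> at \<open>\<nu>\<close>.\<close>

definition fdet :: "nat \<Rightarrow> (nat \<Rightarrow> nat) \<Rightarrow> (nat \<Rightarrow> nat) \<Rightarrow> complex" where
  "fdet N n m = detN N (\<lambda>j i. ffact (of_nat (n i + N - i)) (m j + N - j))"

text \<open>The factor \<open>w\<close> is common to all \<mu> with at most \<open>N\<close> rows;
  its value is never computed, since the empty diagram will determine it.\<close>

lemma schur_par_frob:
  assumes \<nu>: "young \<nu>" "length \<nu> \<le> N"
  obtains w where "\<And>\<mu>. length \<mu> \<le> N \<Longrightarrow>
    schur_par a_half \<mu> (frob_x \<nu>) (frob_y \<nu>) = fdet N (row \<nu>) (row \<mu>) * w"
proof -
  define X where "X i = (of_nat (row \<nu> i) - of_nat i + 1/2 :: complex)" for i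
  define x where "x = map X [1..<N+1]"
  define y where "y = map (\<lambda>i. of_nat i - 1/2 :: complex) [1..<N+1]"
  \<comment> \<open>The shifted nodes are the strictly decreasing numbers
    \<open>row \<nu> i + N - i\<close>, so the nodes are distinct.\<close>
  have X_nat: "X i + of_nat N - 1/2 = of_nat (row \<nu> i + N - i)" if "i \<in> {1..N}" for i
    using that by (simp add: X_def of_nat_diff)
  have inj: "inj_on X {1..N}"
  proof (rule inj_onI)
    have *: "i = k" if "i \<in> {1..N}" "k \<in> {1..N}" "X i = X k" "i \<le> k" for i k
    proof -
      have "complex_of_nat (row \<nu> i + N - i) = of_nat (row \<nu> k + N - k)"
        using X_nat that by metis
      then have "row \<nu> i + N - i = row \<nu> k + N - k" by (simp only: of_nat_eq_iff)
      moreover have "row \<nu> k \<le> row \<nu> i" using row_antimono[OF \<nu>(1)] that by auto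
      ultimately show "i = k" using that by auto
    qed
    fix i k assume "i \<in> {1..N}" "k \<in> {1..N}" "X i = X k"
    then show "i = k" using *[of i k] *[of k i] by (cases "i \<le> k") auto
  qed
  have setx: "set x = X ` {1..N}" by (auto simp: x_def atLeastLessThanSuc_atLeastAtMost)
  have x: "distinct x" "length x = N"
    using inj by (simp_all add: x_def distinct_map atLeastLessThanSuc_atLeastAtMost del: upt_Suc)
  have psum: "psum k (frob_x \<nu>) (frob_y \<nu>) = psum k x y" if "k \<ge> 1" for k
  proof -
    have neg: "(-1) ^ (k - 1) * v ^ k = - ((- v) ^ k)" for v :: complex
      using that by (simp add: minus_power_odd_sign)
    have "psum k x y = (\<Sum>i=1..N. X i ^ k) + (\<Sum>i=1..N. (-1) ^ (k - 1) * (of_nat i - 1/2) ^ k)"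
      unfolding psum_def x_def y_def
      by (simp only: map_map o_def sum_list_distinct_conv_sum_set[OF distinct_upt] set_upt sum_distrib_left
        Suc_eq_plus1[symmetric] atLeastLessThanSuc_atLeastAtMost)
    also have "\<dots> = (\<Sum>i=1..N. X i ^ k - (1/2 - of_nat i) ^ k)"
      unfolding neg by (simp add: sum_negf sum_subtractf)
    finally show ?thesis using psum_frob[OF \<nu> that] by (simp add: X_def)
  qed
  \<comment> \<open>Collects the column product and the Lagrange denominator, both free of
    \<mu>.\<close>
  define W where "W i k = (\<Prod>s\<in>{N-k+1..<N}. of_nat (row \<nu> i + N - i) - of_nat s) /
    (\<Prod>w\<in>set x - {X i}. X i - w)" for i k
  have entry: "hpar (int r - int j + int k) (shift (1 - int k) a_half) x y =
      (\<Sum>i=1..N. ffact (of_nat (row \<nu> i + N - i)) (r + N - j) * W i k)"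
    if "j \<in> {1..N}" "k \<in> {1..N}" for r j k
    unfolding y_def hpar_half_divdiff[OF x that(2,1)] divdiff_def
    unfolding setx sum.reindex[OF inj] o_def W_def
    by (intro sum.cong refl) (simp only: X_nat times_divide_eq_right)
  have "schur_par a_half \<mu> (frob_x \<nu>) (frob_y \<nu>) = fdet N (row \<nu>) (row \<mu>) * detN N W"
    if "length \<mu> \<le> N" for \<mu>
  proof -
    have "schur_par a_half \<mu> (frob_x \<nu>) (frob_y \<nu>) = schur_par a_half \<mu> x y"
      using schur_par_in_Lambda psum by (rule Lambda_cong)
    also have "\<dots> = detN N (\<lambda>i j. hpar (int (row \<mu> i) - int i + int j) (shift (1 - int j) a_half) x y)"
      unfolding schur_par_def using that
      by (intro detN_unitriangular_padding[symmetric]) (auto simp: row_def hpar_def)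
    also have "\<dots> = detN N (\<lambda>j k. \<Sum>i=1..N. ffact (of_nat (row \<nu> i + N - i)) (row \<mu> j + N - j) * W i k)"
      by (intro detN_cong entry)
    finally show ?thesis unfolding fdet_def detN_mult .
  qed
  then show ?thesis using that by blast
qed

section \<open>The Pieri rule and the dimension formula\<close>

text \<open>Monotonicity spreads \<open>n r < m r\<close> to all entries with
  \<open>j \<le> r \<le> i\<close>: there the falling factorial is longer than its natural
  argument.\<close>

lemma fdet_eq_0:
  assumes n: "\<And>i k. 1 \<le> i \<Longrightarrow> i \<le> k \<Longrightarrow> n k \<le> n i" and m: "\<And>i k. 1 \<le> i \<Longrightarrow> i \<le> k \<Longrightarrow> m k \<le> m i"
    and r: "r \<in> {1..N}" "n r < m r"
  shows "fdet N n m = 0"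
  unfolding fdet_def
proof (rule detN_zero_block[OF r(1)])
  fix j i assume "1 \<le> j" "j \<le> r" "r \<le> i" "i \<le> N"
  then have "n i + N - i < m j + N - j" using n[of r i] m[of j r] r by simp
  then show "ffact (of_nat (n i + N - i)) (m j + N - j) = 0" by (rule ffact_of_nat_eq_0)
qed

text \<open>Rows \<open>j - 1\<close> and \<open>j\<close> then have falling factorials of the same
  length. This removes the terms of the Pieri sum that are no diagrams.\<close>

lemma fdet_repeated_row:
  assumes "j \<in> {2..N}" "m (j - 1) = m j"
  shows "fdet N n (m(j := Suc (m j))) = 0"
  unfolding fdet_def
  by (rule detN_equal_rows[of "j - 1" N j]) (use assms in \<open>auto simp: fun_eq_iff\<close>)

text \<open>Adding a box to row \<open>j\<close> multiplies the term of a permutation by z_(p j) -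
  b_j. The sum of these factors over \<open>j\<close> is the same for every permutation, and the
  shifts \<open>N - i\<close> cancel in it.\<close>

lemma fdet_pieri:
  "(\<Sum>j=1..N. fdet N n (m(j := Suc (m j)))) = (\<Sum>i=1..N. of_nat (n i) - of_nat (m i)) * fdet N n m"
proof -
  define z where "z i = complex_of_nat (n i + N - i)" for i
  define b where "b j = m j + N - j" for j
  have summand: "(\<Prod>i=1..N. ffact (z (p i)) ((m(j := Suc (m j))) i + N - i)) =
      (z (p j) - of_nat (b j)) * (\<Prod>i=1..N. ffact (z (p i)) (b i))" if j: "j \<in> {1..N}" for p j
  proof -
    have "(\<Prod>i=1..N. ffact (z (p i)) ((m(j := Suc (m j))) i + N - i)) =
        ffact (z (p j)) (Suc (b j)) * (\<Prod>i\<in>{1..N} - {j}. ffact (z (p i)) (b i))"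
      using j by (subst prod.remove[of _ j]) (auto simp: b_def Suc_diff_le)
    moreover have "(\<Prod>i=1..N. ffact (z (p i)) (b i)) =
        ffact (z (p j)) (b j) * (\<Prod>i\<in>{1..N} - {j}. ffact (z (p i)) (b i))"
      using j by (subst prod.remove[of _ j]) auto
    ultimately show ?thesis by (simp add: ffact_Suc)
  qed
  have "(\<Sum>j=1..N. fdet N n (m(j := Suc (m j)))) = (\<Sum>p | p permutes {1..N}. of_int (sign p) *
      (\<Sum>j=1..N. \<Prod>i=1..N. ffact (z (p i)) ((m(j := Suc (m j))) i + N - i)))"
    unfolding fdet_def detN_def z_def by (subst sum.swap) (simp only: sum_distrib_left)
  also have "\<dots> = (\<Sum>p | p permutes {1..N}. of_int (sign p) *
      ((\<Sum>i=1..N. of_nat (n i) - of_nat (m i)) * (\<Prod>i=1..N. ffact (z (p i)) (b i))))"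
  proof (intro sum.cong refl arg_cong2[where f = "(*)"])
    fix p assume "p \<in> {p. p permutes {1..N}}"
    then have p: "p permutes {1..N}" by simp
    have "(\<Sum>j=1..N. \<Prod>i=1..N. ffact (z (p i)) ((m(j := Suc (m j))) i + N - i)) =
        (\<Sum>j=1..N. z (p j) - of_nat (b j)) * (\<Prod>i=1..N. ffact (z (p i)) (b i))"
      unfolding sum_distrib_right by (intro sum.cong refl summand)
    also have "(\<Sum>j=1..N. z (p j) - of_nat (b j)) = (\<Sum>i=1..N. z i) - (\<Sum>j=1..N. of_nat (b j))"
      using sum.permute[OF p, of z] by (simp add: sum_subtractf o_def)
    also have "\<dots> = (\<Sum>i=1..N. of_nat (n i) - of_nat (m i))"
      unfolding sum_subtractf[symmetric]
      by (intro sum.cong refl) (auto simp: z_def b_def of_nat_diff)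
    finally show "(\<Sum>j=1..N. \<Prod>i=1..N. ffact (z (p i)) ((m(j := Suc (m j))) i + N - i)) =
      (\<Sum>i=1..N. of_nat (n i) - of_nat (m i)) * (\<Prod>i=1..N. ffact (z (p i)) (b i))" .
  qed
  also have "\<dots> = (\<Sum>i=1..N. of_nat (n i) - of_nat (m i)) * fdet N n m"
    unfolding fdet_def detN_def sum_distrib_left by (simp add: z_def b_def mult_ac)
  finally show ?thesis .
qed

text \<open>Row lengths are a function here, so that adding a box, even in a new row, is a function
  update.\<close>

definition diagram :: "(nat \<Rightarrow> nat) \<Rightarrow> (nat \<times> nat) set" where
  "diagram m = {(i, j). 1 \<le> i \<and> 1 \<le> j \<and> j \<le> m i}"

lemma cells_eq_diagram: "cells \<nu> = diagram (row \<nu>)"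
  by (simp add: cells_eq diagram_def)

text \<open>Identifies the summands of \<open>card_syt_rec\<close> with the boxes that can be added
  to \<open>m\<close> inside \<open>n\<close>.\<close>

lemma min_cells_skew:
  assumes n: "\<And>i k. 1 \<le> i \<Longrightarrow> i \<le> k \<Longrightarrow> n k \<le> n i" and m: "\<And>i k. 1 \<le> i \<Longrightarrow> i \<le> k \<Longrightarrow> m k \<le> m i"
    and N: "\<And>i. i > N \<Longrightarrow> n i = 0"
  defines "S \<equiv> diagram n - diagram m"
  shows "{c. c \<in> S \<and> min_cell S c} =
    (\<lambda>j. (j, Suc (m j))) ` {j \<in> {1..N}. m j < n j \<and> (j = 1 \<or> m j < m (j - 1))}"
proof (intro set_eqI iffI)
  have mem: "(i, j) \<in> S \<longleftrightarrow> 1 \<le> i \<and> m i < j \<and> j \<le> n i" for i j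
    by (auto simp: S_def diagram_def)
  {
    fix c assume "c \<in> {c. c \<in> S \<and> min_cell S c}"
    then obtain i j where c: "c = (i, j)" "(i, j) \<in> S" "min_cell S (i, j)" by (cases c) auto
    have ij: "1 \<le> i" "m i < j" "j \<le> n i" using c mem by auto
    have "(i, Suc (m i)) \<in> S" using ij mem by auto
    then have j: "j = Suc (m i)" using c(3) ij by (auto simp: min_cell_def)
    have "i \<le> N" using N[of i] ij by (cases "i \<le> N") auto
    moreover have "i = 1 \<or> m i < m (i - 1)"
    proof (rule ccontr)
      assume "\<not> (i = 1 \<or> m i < m (i - 1))"
      then have i: "i \<noteq> 1" "m (i - 1) \<le> m i" by auto
      then have "1 \<le> i - 1" using ij(1) by simp
      then have "n i \<le> n (i - 1)" by (intro n) auto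
      \<comment> \<open>The box above lies in the skew shape too, against minimality.\<close>
      then have "(i - 1, j) \<in> S" using \<open>1 \<le> i - 1\<close> ij i by (simp add: mem)
      then show False using c(3) ij by (auto simp: min_cell_def)
    qed
    ultimately show "c \<in> (\<lambda>j. (j, Suc (m j))) ` {j \<in> {1..N}. m j < n j \<and> (j = 1 \<or> m j < m (j - 1))}"
      using c ij j by auto
  next
    fix c assume "c \<in> (\<lambda>j. (j, Suc (m j))) ` {j \<in> {1..N}. m j < n j \<and> (j = 1 \<or> m j < m (j - 1))}"
    then obtain j where j: "c = (j, Suc (m j))" "1 \<le> j" "m j < n j" "j = 1 \<or> m j < m (j - 1)" by auto
    have "j \<le> i" if "(i, Suc (m j)) \<in> S" for i
    proof (rule ccontr)
      assume "\<not> j \<le> i"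
      moreover have i: "1 \<le> i" "m i \<le> m j" using that mem by auto
      ultimately have "i \<le> j - 1" "m j < m (j - 1)" using j by auto
      then show False using m[OF i(1)] i(2) by fastforce
    qed
    moreover have "Suc (m j) \<le> i" if "(j, i) \<in> S" for i using that mem by auto
    ultimately show "c \<in> {c. c \<in> S \<and> min_cell S c}" using j mem by (auto simp: min_cell_def)
  }
qed

text \<open>The Pieri rule for \<open>fdet\<close> is the recursion of the number of skew tableaux obtained by
  deleting the entry 1, with the inadmissible terms vanishing.\<close>

lemma fdet_eq_card_syt:
  assumes n: "\<And>i k. 1 \<le> i \<Longrightarrow> i \<le> k \<Longrightarrow> n k \<le> n i" and N: "\<And>i. i > N \<Longrightarrow> n i = 0"
    and "\<And>i k. 1 \<le> i \<Longrightarrow> i \<le> k \<Longrightarrow> m k \<le> m i"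
    and "\<And>i. 1 \<le> i \<Longrightarrow> m i \<le> n i" and "(\<Sum>i=1..N. n i) = (\<Sum>i=1..N. m i) + d"
  shows "fdet N n m * fact d = of_nat (card (syt (diagram n - diagram m))) * fdet N n n"
  using assms(3-5)
proof (induction d arbitrary: m)
  case 0
  have eq: "m i = n i" if "i \<in> {1..N}" for i
  proof (rule ccontr)
    assume "m i \<noteq> n i"
    then have "m i < n i" using 0(2)[of i] that by simp
    then have "(\<Sum>i=1..N. m i) < (\<Sum>i=1..N. n i)"
      using 0(2) that by (intro sum_strict_mono_ex1) auto
    then show False using 0(3) by simp
  qed
  have "m i = n i" if "1 \<le> i" for i
    using eq[of i] N[of i] 0(2)[OF that] that by (cases "i \<le> N") auto
  then have S: "diagram n - diagram m = {}" by (auto simp: diagram_def)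
  have "fdet N n m = fdet N n n"
    unfolding fdet_def by (intro detN_cong) (simp add: eq)
  then show ?case unfolding S by (simp add: syt_empty)
next
  case (Suc d)
  let ?S = "diagram n - diagram m"
  let ?J = "{j \<in> {1..N}. m j < n j \<and> (j = 1 \<or> m j < m (j - 1))}"
  let ?m = "\<lambda>j. m(j := Suc (m j))"
  \<comment> \<open>Only row \<open>j\<close> grows, so the comparison at risk is with rows above
    it, where \<open>m j < m (j - 1)\<close> leaves room.\<close>
  have anti: "?m j k \<le> ?m j i" if "j = 1 \<or> m j < m (j - 1)" "1 \<le> i" "i \<le> k" for i j k
  proof (cases "k = j \<and> i < j")
    case True
    then have "m (j - 1) \<le> m i" "m j < m (j - 1)" using Suc.prems(1)[of i "j - 1"] that by auto
    then show ?thesis using True by simp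
  qed (use Suc.prems(1)[OF that(2,3)] that in auto)
  have step: "fdet N n (?m j) * fact d = of_nat (card (syt (?S - {(j, Suc (m j))}))) * fdet N n n" if j: "j \<in> ?J" for j
  proof -
    have "fdet N n (?m j) * fact d = of_nat (card (syt (diagram n - diagram (?m j)))) * fdet N n n"
    proof (rule Suc.IH)
      show "?m j k \<le> ?m j i" if "1 \<le> i" "i \<le> k" for i k using anti j that by blast
      show "?m j i \<le> n i" if "1 \<le> i" for i using j Suc.prems(2)[OF that] by auto
      have "(\<Sum>i=1..N. ?m j i) = Suc (\<Sum>i=1..N. m i)"
      proof -
        have "(\<Sum>i\<in>{1..N} - {j}. ?m j i) = (\<Sum>i\<in>{1..N} - {j}. m i)" by (intro sum.cong) auto
        moreover have "j \<in> {1..N}" using j by simp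
        ultimately show ?thesis
          using sum.remove[of "{1..N}" j "?m j"] sum.remove[of "{1..N}" j m] by simp
      qed
      then show "(\<Sum>i=1..N. n i) = (\<Sum>i=1..N. ?m j i) + d" using Suc.prems(3) by simp
    qed
    also have "diagram n - diagram (?m j) = ?S - {(j, Suc (m j))}"
      by (auto simp: diagram_def split: if_splits)
    finally show ?thesis .
  qed
  \<comment> \<open>Either the new box leaves \<open>n\<close>, or the new row lengths fail to
    decrease and two matrix rows coincide.\<close>
  have zero: "fdet N n (?m j) = 0" if "j \<in> {1..N} - ?J" for j
  proof (cases "j = 1 \<or> m j < m (j - 1)")
    case True
    then have "n j < ?m j j" using that by auto
    then show ?thesis using that n anti[OF True] by (intro fdet_eq_0[of n "?m j" j]) auto
  next
    case False
    then have "m (j - 1) = m j" using that Suc.prems(1)[of "j - 1" j] by auto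
    then show ?thesis using that False by (intro fdet_repeated_row) auto
  qed
  have fin: "finite ?S"
  proof (rule finite_subset)
    show "?S \<subseteq> {1..N} \<times> {1..n 1}"
    proof
      fix c assume "c \<in> ?S"
      then obtain i j where c: "c = (i, j)" "1 \<le> i" "1 \<le> j" "j \<le> n i" by (auto simp: diagram_def)
      then show "c \<in> {1..N} \<times> {1..n 1}" using n[of 1 i] N[of i] by (cases "i \<le> N") auto
    qed
  qed simp
  have "?S \<noteq> {}"
  proof
    assume S: "?S = {}"
    have "n i \<le> m i" if "1 \<le> i" for i
    proof (rule ccontr)
      assume "\<not> n i \<le> m i"
      then have "(i, n i) \<in> ?S" using that by (auto simp: diagram_def)
      then show False using S by simp
    qed
    then have "(\<Sum>i=1..N. n i) \<le> (\<Sum>i=1..N. m i)" by (intro sum_mono) auto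
    then show False using Suc.prems(3) by simp
  qed
  then have "card (syt ?S) = (\<Sum>c | c \<in> ?S \<and> min_cell ?S c. card (syt (?S - {c})))"
    using fin by (intro card_syt_rec)
  also have "{c. c \<in> ?S \<and> min_cell ?S c} = (\<lambda>j. (j, Suc (m j))) ` ?J"
    by (rule min_cells_skew) (use n Suc.prems(1) N in auto)
  also have "(\<Sum>c\<in>(\<lambda>j. (j, Suc (m j))) ` ?J. card (syt (?S - {c}))) =
      (\<Sum>j\<in>?J. card (syt (?S - {(j, Suc (m j))})))"
    by (subst sum.reindex) (auto simp: inj_on_def)
  finally have "of_nat (card (syt ?S)) * fdet N n n = (\<Sum>j\<in>?J. fdet N n (?m j) * fact d)"
    by (simp add: sum_distrib_right step)
  also have "\<dots> = (\<Sum>j=1..N. fdet N n (?m j)) * fact d"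
    unfolding sum_distrib_right by (rule sum.mono_neutral_left) (use zero in auto)
  \<comment> \<open>The scalar in the Pieri rule is the number of missing boxes, which completes
    \<open>fact d\<close> to \<open>fact (Suc d)\<close>.\<close>
  also have "\<dots> = of_nat (Suc d) * fdet N n m * fact d"
  proof -
    have "(\<Sum>i=1..N. of_nat (n i) - of_nat (m i) :: complex) = of_nat (Suc d)"
      unfolding sum_subtractf of_nat_sum[symmetric] Suc.prems(3) by simp
    then show ?thesis unfolding fdet_pieri by simp
  qed
  finally show ?case by (simp add: algebra_simps)
qed

section \<open>Normalisation and the quotient of dimensions\<close>

lemma sum_row:
  assumes "length \<nu> \<le> N" shows "(\<Sum>i=1..N. row \<nu> i) = sum_list \<nu>"
proof -
  have "(\<Sum>i=1..N. row \<nu> i) = (\<Sum>i=1..length \<nu>. row \<nu> i)"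
    using assms by (intro sum.mono_neutral_right) (auto simp: row_def)
  also have "\<dots> = (\<Sum>i<length \<nu>. \<nu> ! i)"
    by (rule sum.reindex_bij_witness[of _ Suc "\<lambda>i. i - 1"]) (auto simp: row_def)
  finally show ?thesis by (simp add: sum_list_sum_nth atLeast0LessThan)
qed

lemma prod_falling_fact:
  "m \<le> n \<Longrightarrow> (\<Prod>t<m. of_nat (n - t) :: complex) * fact (n - m) = fact n"
proof (induction m)
  case (Suc m)
  then have "(fact (n - m) :: complex) = of_nat (n - m) * fact (n - Suc m)"
    by (metis Suc_diff_Suc Suc_le_lessD fact_Suc)
  then show ?case using Suc by (simp add: mult_ac)
qed simp

text \<open>The formula \<open>dim\<close> holds for \<mu> and for the empty diagram with the same
  constant \<open>c\<close>, which drops out of the quotient.\<close>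

lemma FS_property_schur_par:
  assumes \<mu>: "young \<mu>"
  shows "FS_property \<mu> (schur_par a_half \<mu>)"
  unfolding FS_property_def
proof (intro allI impI, elim conjE)
  fix \<nu> assume \<nu>: "young \<nu>" and le: "sum_list \<mu> \<le> sum_list \<nu>"
  define N where "N = max (length \<mu>) (length \<nu>)"
  let ?s = "\<lambda>\<mu>. schur_par a_half \<mu> (frob_x \<nu>) (frob_y \<nu>)"
  let ?n = "sum_list \<nu>" and ?m = "sum_list \<mu>"
  have N: "length \<mu> \<le> N" "length \<nu> \<le> N" by (auto simp: N_def)
  obtain w where w: "\<And>\<mu>. length \<mu> \<le> N \<Longrightarrow> ?s \<mu> = fdet N (row \<nu>) (row \<mu>) * w"
    using schur_par_frob[OF \<nu> N(2)] by blast
  define c where "c = fdet N (row \<nu>) (row \<nu>) * w"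
  have dim: "?s \<kappa> * fact (?n - sum_list \<kappa>) = of_nat (dimsk \<kappa> \<nu>) * c"
    if "young \<kappa>" "length \<kappa> \<le> N" "cells \<kappa> \<subseteq> cells \<nu>" "sum_list \<kappa> \<le> ?n" for \<kappa>
  proof -
    have sub: "row \<kappa> i \<le> row \<nu> i" if "1 \<le> i" for i
    proof (rule ccontr)
      assume "\<not> row \<kappa> i \<le> row \<nu> i"
      then have "(i, row \<kappa> i) \<in> cells \<kappa> - cells \<nu>" using that by (auto simp: cells_eq)
      then show False using \<open>cells \<kappa> \<subseteq> cells \<nu>\<close> by blast
    qed
    have "fdet N (row \<nu>) (row \<kappa>) * fact (?n - sum_list \<kappa>) =
        of_nat (card (syt (diagram (row \<nu>) - diagram (row \<kappa>)))) * fdet N (row \<nu>) (row \<nu>)"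
    proof (rule fdet_eq_card_syt)
      show "row \<nu> i = 0" if "N < i" for i using that N by (simp add: row_def)
      show "sum (row \<nu>) {1..N} = sum (row \<kappa>) {1..N} + (?n - sum_list \<kappa>)"
        using that N sum_row by simp
    qed (use row_antimono \<nu> that sub in auto)
    then show ?thesis using that
      by (simp add: w c_def dimsk_def std_tableaux_eq_syt cells_eq_diagram[symmetric] mult_ac)
  qed
  \<comment> \<open>The determinant of size 0 is 1. This makes \<open>dimd \<nu>\<close> times
    \<open>c\<close> a factorial, so neither is 0.\<close>
  have "?s [] = 1" by (simp add: schur_par_def detN_def)
  then have dim0: "fact ?n = of_nat (dimd \<nu>) * c"
    using dim[of "[]"] by (auto simp: dimd_def young_def cells_def)
  have "of_nat (dimd \<nu>) * c \<noteq> 0" unfolding dim0[symmetric] by simp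
  then have nz: "of_nat (dimd \<nu>) \<noteq> (0 :: complex)" "c \<noteq> 0" by simp_all
  have P: "(\<Prod>t<?m. of_nat (?n - t) :: complex) * fact (?n - ?m) = fact ?n"
    using le by (rule prod_falling_fact)
  then have P0: "(\<Prod>t<?m. of_nat (?n - t) :: complex) \<noteq> 0" by (metis fact_nonzero mult_zero_left)
  show "of_nat (dimsk \<mu> \<nu>) / of_nat (dimd \<nu>) = ?s \<mu> / (\<Prod>t<?m. of_nat (?n - t))"
  proof (cases "cells \<mu> \<subseteq> cells \<nu>")
    case True
    let ?P = "\<Prod>t<?m. of_nat (?n - t) :: complex"
    have "fact (?n - ?m) * (of_nat (dimsk \<mu> \<nu>) * ?P) = fact ?n * of_nat (dimsk \<mu> \<nu>)"
      using P by (simp add: mult_ac)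
    also have "\<dots> = of_nat (dimd \<nu>) * (of_nat (dimsk \<mu> \<nu>) * c)"
      unfolding dim0 by (simp add: mult_ac)
    also have "\<dots> = fact (?n - ?m) * (?s \<mu> * of_nat (dimd \<nu>))"
      using dim[OF \<mu> N(1) True le] by (simp add: mult_ac)
    finally have "of_nat (dimsk \<mu> \<nu>) * ?P = ?s \<mu> * of_nat (dimd \<nu>)"
      by (simp only: mult_cancel_left fact_nonzero simp_thms)
    then show ?thesis using nz P0 by (intro frac_eq_eq[THEN iffD2])
  next
    case False
    then obtain i j where "1 \<le> i" "1 \<le> j" "j \<le> row \<mu> i" "\<not> j \<le> row \<nu> i" by (auto simp: cells_eq)
    then have i: "i \<in> {1..N}" "row \<nu> i < row \<mu> i" using N by (auto simp: row_def split: if_splits)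
    then have "fdet N (row \<nu>) (row \<mu>) = 0"
      using row_antimono \<nu> \<mu> by (intro fdet_eq_0[of _ _ i]) auto
    then show ?thesis using False w[OF N(1)] by (simp add: dimsk_def)
  qed
qed

section \<open>Uniqueness\<close>

text \<open>Adding or deleting a coordinate \<open>v\<close> changes the power sums by s v^k with s
  = 1 or s = -1, which is polynomial in \<open>v\<close>.\<close>

lemma poly_fun_line:
  "F \<in> poly_fun \<Longrightarrow> \<exists>q. \<forall>v. F (\<lambda>k. c k + s * v ^ k) = poly q v"
proof (induction rule: poly_fun.induct)
  case (const a)
  show ?case by (rule exI[of _ "[:a:]"]) simp
next
  case (var k)
  show ?case by (rule exI[of _ "[:c k:] + monom s k"]) (simp add: poly_monom)
next
  case (add F G)
  then obtain p q where "\<forall>v. F (\<lambda>k. c k + s * v ^ k) = poly p v" "\<forall>v. G (\<lambda>k. c k + s * v ^ k) = poly q v"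
    by blast
  then show ?case by (intro exI[of _ "p + q"]) simp
next
  case (mult F G)
  then obtain p q where "\<forall>v. F (\<lambda>k. c k + s * v ^ k) = poly p v" "\<forall>v. G (\<lambda>k. c k + s * v ^ k) = poly q v"
    by blast
  then show ?case by (intro exI[of _ "p * q"]) simp
qed

text \<open>A polynomial with infinitely many roots is zero. This releases one coordinate from a
  discrete set to all complex values.\<close>

lemma poly_fun_zero_extend:
  assumes "F \<in> poly_fun" "infinite V" "\<And>v. v \<in> V \<Longrightarrow> F (\<lambda>k. c k + s * v ^ k) = 0"
  shows "F (\<lambda>k. c k + s * v ^ k) = 0"
proof -
  obtain q where q: "\<And>v. F (\<lambda>k. c k + s * v ^ k) = poly q v" using poly_fun_line[OF assms(1)] by blast
  have "q = 0"
  proof (rule ccontr)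
    assume "q \<noteq> 0"
    then have "finite {v. poly q v = 0}" by (rule poly_roots_finite)
    moreover have "V \<subseteq> {v. poly q v = 0}" using assms(3) q by auto
    ultimately show False using assms(2) finite_subset by blast
  qed
  then show ?thesis using q by simp
qed

text \<open>Strips the zero rows that \<open>young\<close> excludes but the induction over rows
  produces.\<close>

lemma sorted_desc_zeros:
  "sorted_wrt (\<ge>) (r :: nat list) \<Longrightarrow> \<exists>z. r = filter (\<lambda>t. t > 0) r @ replicate z 0"
proof (induction r)
  case (Cons a r)
  show ?case
  proof (cases "a = 0")
    case True
    then have "\<forall>t\<in>set (a # r). t = 0" using Cons.prems by auto
    then have "a # r = replicate (length (a # r)) 0" by (intro replicate_eqI) auto
    moreover have "filter (\<lambda>t. t > 0) (a # r) = []"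
      using \<open>\<forall>t\<in>set (a # r). t = 0\<close> by (simp add: filter_empty_conv)
    ultimately show ?thesis by (intro exI[of _ "length (a # r)"]) simp
  next
    case False
    then show ?thesis using Cons by auto
  qed
qed simp

context
  fixes F and M :: nat
  assumes F: "F \<in> poly_fun"
    and frob: "\<And>\<nu>. young \<nu> \<Longrightarrow> M \<le> sum_list \<nu> \<Longrightarrow> F (\<lambda>k. psum k (frob_x \<nu>) (frob_y \<nu>)) = 0"
begin

text \<open>The coordinates of the first rows are already free (\<open>t\<close>), the others still
  come from row lengths \<open>r\<close>. The last free coordinate is obtained from arbitrarily long
  rows placed before \<open>r\<close>; such a row also meets the bound \<open>M\<close>.\<close>

lemma vanish_rows:
  assumes "sorted_wrt (\<ge>) r" "t \<noteq> [] \<or> M \<le> sum_list r"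
  shows "F (\<lambda>k. (\<Sum>v\<leftarrow>t. v ^ k) + (\<Sum>i<length r. (of_nat (r ! i) - of_nat (length t + i + 1) + 1/2) ^ k)
      - (\<Sum>i=1..length t + length r. (1/2 - of_nat i) ^ k)) = 0"
  using assms
proof (induction t arbitrary: r rule: rev_induct)
  case Nil
  define \<nu> where "\<nu> = filter (\<lambda>t. t > 0) r"
  obtain z where z: "r = \<nu> @ replicate z 0" using sorted_desc_zeros[OF Nil(1)] by (auto simp: \<nu>_def)
  have y: "young \<nu>" unfolding young_def \<nu>_def using Nil(1) by (auto simp: sorted_wrt_filter)
  have len: "length \<nu> \<le> length r" by (simp add: \<nu>_def)
  have "sum_list r = sum_list \<nu>" by (subst z) (simp add: sum_list_replicate)
  then have "F (\<lambda>k. psum k (frob_x \<nu>) (frob_y \<nu>)) = 0" using Nil y by (intro frob) auto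
  moreover have "F (\<lambda>k. psum k (frob_x \<nu>) (frob_y \<nu>)) = F (\<lambda>k. (\<Sum>v\<leftarrow>[]. v ^ k) +
      (\<Sum>i<length r. (of_nat (r ! i) - of_nat (length [] + i + 1) + 1/2) ^ k)
      - (\<Sum>i=1..length [] + length r. (1/2 - of_nat i) ^ k))"
  proof (rule poly_fun_cong[OF F])
    fix k :: nat assume k: "k \<ge> 1"
    have row: "row \<nu> (Suc i) = r ! i" if "i < length r" for i
      using that by (subst z) (auto simp: row_def nth_append z)
    have "(\<Sum>i=1..length r. (of_nat (row \<nu> i) - of_nat i + 1/2 :: complex) ^ k) =
        (\<Sum>i<length r. (of_nat (r ! i) - of_nat (i + 1) + 1/2) ^ k)"
      by (rule sum.reindex_bij_witness[of _ Suc "\<lambda>i. i - 1"]) (auto simp: row[symmetric])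
    then show "psum k (frob_x \<nu>) (frob_y \<nu>) = (\<Sum>v\<leftarrow>[]. v ^ k) +
      (\<Sum>i<length r. (of_nat (r ! i) - of_nat (length [] + i + 1) + 1/2) ^ k)
      - (\<Sum>i=1..length [] + length r. (1/2 - of_nat i) ^ k)"
      using psum_frob[OF y len k] by (simp add: sum_subtractf)
  qed
  ultimately show ?case by simp
next
  case (snoc v t)
  let ?l = "length t"
  \<comment> \<open>Rows of length at least \<open>b\<close> keep the list decreasing and its size
    at least \<open>M\<close>.\<close>
  define b where "b = M + (if r = [] then 0 else hd r)"
  let ?c = "\<lambda>k. (\<Sum>v\<leftarrow>t. v ^ k) + (\<Sum>i<length r. (of_nat (r ! i) - of_nat (Suc ?l + i + 1) + 1/2 :: complex) ^ k)
      - (\<Sum>i=1..Suc ?l + length r. (1/2 - of_nat i) ^ k)"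
  let ?V = "(\<lambda>n. of_nat n - of_nat (?l + 1) + 1/2 :: complex) ` {b..}"
  have "inj_on (\<lambda>n. of_nat n - of_nat (?l + 1) + 1/2 :: complex) {b..}" by (auto simp: inj_on_def)
  then have "infinite ?V" by (simp add: finite_image_iff infinite_Ici)
  moreover have "F (\<lambda>k. ?c k + 1 * v ^ k) = 0" if v: "v \<in> ?V" for v
  proof -
    obtain n where n: "n \<ge> b" "v = of_nat n - of_nat (?l + 1) + 1/2" using v by auto
    have "s \<le> n" if "s \<in> set r" for s
    proof -
      have "s \<le> hd r" using that snoc.prems(1) by (cases r) auto
      then show ?thesis using n that by (auto simp: b_def split: if_splits)
    qed
    then have "sorted_wrt (\<ge>) (n # r)" using snoc.prems(1) by simp
    moreover have "M \<le> sum_list (n # r)" using n by (simp add: b_def)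
    ultimately have "F (\<lambda>k. (\<Sum>v\<leftarrow>t. v ^ k) + (\<Sum>i<length (n # r). (of_nat ((n # r) ! i) - of_nat (?l + i + 1) + 1/2) ^ k)
      - (\<Sum>i=1..?l + length (n # r). (1/2 - of_nat i) ^ k)) = 0" by (intro snoc.IH) auto
    moreover have "(\<Sum>i<length (n # r). (of_nat ((n # r) ! i) - of_nat (?l + i + 1) + 1/2 :: complex) ^ k) =
       v ^ k + (\<Sum>i<length r. (of_nat (r ! i) - of_nat (Suc ?l + i + 1) + 1/2) ^ k)" for k
      unfolding n(2) length_Cons sum.lessThan_Suc_shift by (simp add: algebra_simps)
    ultimately show ?thesis by (simp add: algebra_simps)
  qed
  ultimately have "F (\<lambda>k. ?c k + 1 * v ^ k) = 0" by (rule poly_fun_zero_extend[OF F])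
  then show ?case by (simp add: algebra_simps)
qed

text \<open>Choosing the coordinates \<open>t\<close> above among the points \<open>1/2 - i\<close> cancels all but finitely many
  prescribed ones, which can then be moved to arbitrary positions.\<close>

lemma vanish_balanced:
  assumes "finite I" "0 \<notin> I" "length x = length w + card I"
  shows "F (\<lambda>k. (\<Sum>v\<leftarrow>x. v ^ k) - (\<Sum>v\<leftarrow>w. v ^ k) - (\<Sum>i\<in>I. (1/2 - of_nat i) ^ k)) = 0"
  using assms
proof (induction w arbitrary: I)
  case Nil
  \<comment> \<open>Inserting 1 makes \<open>N\<close> positive, hence \<open>t\<close> nonempty,
    also when \<open>I\<close> is empty.\<close>
  define N where "N = Max (insert 1 I)"
  have "i \<le> N" if "i \<in> insert 1 I" for i
    unfolding N_def using Nil.prems(1) that by (intro Max_ge) auto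
  then have N: "1 \<le> N" "I \<subseteq> {1..N}" using Nil.prems(2) by (auto simp: Suc_le_eq intro: gr0I)
  \<comment> \<open>The points with index outside \<open>I\<close> cancel; the length is
    \<open>N\<close> because \<open>x\<close> has as many entries as \<open>I\<close>.\<close>
  define t where "t = x @ map (\<lambda>i. 1/2 - of_nat i :: complex) (sorted_list_of_set ({1..N} - I))"
  have "card I \<le> N" using card_mono[OF _ N(2)] by simp
  then have len: "length t = N" using Nil N by (simp add: t_def card_Diff_subset)
  have "F (\<lambda>k. (\<Sum>v\<leftarrow>t. v ^ k) + (\<Sum>i<length ([] :: nat list). (of_nat ([] ! i) - of_nat (length t + i + 1) + 1/2) ^ k)
      - (\<Sum>i=1..length t + length ([] :: nat list). (1/2 - of_nat i) ^ k)) = 0"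
    by (rule vanish_rows) (use len N in auto)
  moreover have "(\<Sum>v\<leftarrow>t. v ^ k) - (\<Sum>i=1..N. (1/2 - of_nat i) ^ k) =
      (\<Sum>v\<leftarrow>x. v ^ k) - (\<Sum>i\<in>I. (1/2 - of_nat i) ^ k)" for k
  proof -
    have "(\<Sum>v\<leftarrow>t. v ^ k) = (\<Sum>v\<leftarrow>x. v ^ k) + (\<Sum>i\<in>{1..N} - I. (1/2 - of_nat i) ^ k)"
      by (simp add: t_def o_def sum_list_distinct_conv_sum_set)
    moreover have "(\<Sum>i=1..N. (1/2 - of_nat i :: complex) ^ k) =
        (\<Sum>i\<in>{1..N} - I. (1/2 - of_nat i) ^ k) + (\<Sum>i\<in>I. (1/2 - of_nat i) ^ k)"
      using N by (intro sum.subset_diff) auto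
    ultimately show ?thesis by simp
  qed
  ultimately show ?case using len by simp
next
  case (Cons v w)
  let ?c = "\<lambda>k. (\<Sum>v\<leftarrow>x. v ^ k) - (\<Sum>v\<leftarrow>w. v ^ k) - (\<Sum>i\<in>I. (1/2 - of_nat i) ^ k)"
  \<comment> \<open>At such a point the subtracted coordinate is absorbed into \<open>I\<close> by a
    fresh index.\<close>
  let ?V = "(\<lambda>i. 1/2 - of_nat i :: complex) ` ({1..} - I)"
  have "inj_on (\<lambda>i. 1/2 - of_nat i :: complex) ({1..} - I)" by (auto simp: inj_on_def)
  moreover have "infinite ({1..} - I)" using Cons.prems(1) infinite_Ici by (rule Diff_infinite_finite)
  ultimately have "infinite ?V" by (simp add: finite_image_iff)
  moreover have "F (\<lambda>k. ?c k + (-1) * v ^ k) = 0" if v: "v \<in> ?V" for v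
  proof -
    obtain i where i: "i \<ge> 1" "i \<notin> I" "v = 1/2 - of_nat i" using v by auto
    have "F (\<lambda>k. (\<Sum>v\<leftarrow>x. v ^ k) - (\<Sum>v\<leftarrow>w. v ^ k) - (\<Sum>i\<in>insert i I. (1/2 - of_nat i) ^ k)) = 0"
      by (rule Cons.IH) (use Cons.prems i in auto)
    then show ?thesis unfolding i(3) using i(2) Cons.prems(1) by (simp add: algebra_simps)
  qed
  ultimately have "F (\<lambda>k. ?c k + (-1) * v ^ k) = 0" by (rule poly_fun_zero_extend[OF F])
  then show ?case by (simp add: algebra_simps)
qed

text \<open>Entries of \<open>y\<close> become subtracted coordinates of opposite sign. Zeros pad
  both lists to equal length and do not affect power sums of positive degree.\<close>

lemma vanish_psum: "F (\<lambda>k. psum k x y) = 0"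
proof -
  define x' where "x' = x @ replicate (length y) 0"
  define w where "w = map uminus y @ replicate (length x) 0"
  have "F (\<lambda>k. (\<Sum>v\<leftarrow>x'. v ^ k) - (\<Sum>v\<leftarrow>w. v ^ k) - (\<Sum>i\<in>{}. (1/2 - of_nat i) ^ k)) = 0"
    by (rule vanish_balanced) (auto simp: x'_def w_def)
  moreover have "F (\<lambda>k. psum k x y) =
      F (\<lambda>k. (\<Sum>v\<leftarrow>x'. v ^ k) - (\<Sum>v\<leftarrow>w. v ^ k) - (\<Sum>i\<in>{}. (1/2 - of_nat i) ^ k))"
  proof (rule poly_fun_cong[OF F])
    fix k :: nat assume k: "k \<ge> 1"
    have "(\<Sum>v\<leftarrow>w. v ^ k) = - ((-1) ^ (k - 1) * (\<Sum>v\<leftarrow>y. v ^ k))"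
      using k unfolding w_def by (induction y) (simp_all add: sum_list_replicate minus_power_odd_sign distrib_left)
    moreover have "(\<Sum>v\<leftarrow>x'. v ^ k) = (\<Sum>v\<leftarrow>x. v ^ k)"
      using k by (simp add: x'_def sum_list_replicate)
    ultimately show "psum k x y = (\<Sum>v\<leftarrow>x'. v ^ k) - (\<Sum>v\<leftarrow>w. v ^ k) - (\<Sum>i\<in>{}. (1/2 - of_nat i) ^ k)"
      by (simp add: psum_def)
  qed
  ultimately show ?thesis by simp
qed

end

lemma FS_unique:
  assumes f: "f \<in> Lambda" "FS_property \<mu> f" and g: "g \<in> Lambda" "FS_property \<mu> g"
  shows "f = g"
proof -
  obtain F where F: "F \<in> poly_fun" "\<And>x y. f x y = F (\<lambda>k. psum k x y)" using Lambda_poly_fun[OF f(1)] by blast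
  obtain G where G: "G \<in> poly_fun" "\<And>x y. g x y = G (\<lambda>k. psum k x y)" using Lambda_poly_fun[OF g(1)] by blast
  let ?H = "\<lambda>p. F p + (-1) * G p"
  have H: "?H \<in> poly_fun" using F G by (intro poly_fun.intros)
  have "?H (\<lambda>k. psum k (frob_x \<nu>) (frob_y \<nu>)) = 0" if \<nu>: "young \<nu>" "sum_list \<mu> \<le> sum_list \<nu>" for \<nu>
  proof -
    \<comment> \<open>Each factor is positive because the size of \<nu> is at least that of \<mu>,
      so the denominators can be cleared.\<close>
    have "(\<Prod>t<sum_list \<mu>. of_nat (sum_list \<nu> - t) :: complex) \<noteq> 0" using \<nu>(2) by simp
    moreover have "f (frob_x \<nu>) (frob_y \<nu>) / (\<Prod>t<sum_list \<mu>. of_nat (sum_list \<nu> - t)) =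
        g (frob_x \<nu>) (frob_y \<nu>) / (\<Prod>t<sum_list \<mu>. of_nat (sum_list \<nu> - t))"
      using f(2) g(2) \<nu> unfolding FS_property_def by metis
    ultimately show ?thesis using F G by simp
  qed
  then have "?H (\<lambda>k. psum k x y) = 0" for x y by (rule vanish_psum[OF H])
  then show ?thesis using F G by (simp add: fun_eq_iff)
qed

theorem theorem3:
  assumes "young \<mu>"
  shows "FS \<mu> = schur_par a_half \<mu>"
  unfolding FS_def
proof (rule the_equality)
  show "schur_par a_half \<mu> \<in> Lambda \<and> FS_property \<mu> (schur_par a_half \<mu>)"
    using schur_par_in_Lambda FS_property_schur_par[OF assms] by blast
  then show "f = schur_par a_half \<mu>" if "f \<in> Lambda \<and> FS_property \<mu> f" for f
    using that FS_unique by blast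
qed

end
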